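(* Let $\Gamma$ be a finitely generated and recursively presented group. For any effective dynamical system $\Gamma \curvearrowright X$ there exist an effectively closed zero-dimensional space $\widetilde{X}\subset \{0,1\}^{\mathbb{N}}$ and a computable action $\Gamma \curvearrowright \widetilde{X}$ such that $\Gamma \curvearrowright X$ is a topological factor of $\Gamma \curvearrowright \widetilde{X}$.
   Context: All actions are by homeomorphisms on compact metrizable spaces; zero-dimensional means compact, metrizable and of topological dimension zero. "Algorithm" means Turing machine; r.e. means recursively enumerable. A finitely generated group $\Gamma$ is recursively presented if for some (equivalently, any) finite symmetric generating set $S$ the set $\{w\in S^*: \underline{w}=1_\Gamma\}$ is r.e., where $\underline{w}\in\Gamma$ is the element represented by the word $w$. A topological factor map from $\Gamma\curvearrowright X$ to $\Gamma\curvearrowright Y$ is a continuous surjective $\Gamma$-equivariant map $f\colon X\to Y$ (then $\Gamma\curvearrowright Y$ is a topological factor of $\Gamma\curvearrowright X$); it is a topological conjugacy if it is a homeomorphism. Cantor space. For a finite alphabet $A$ and a word $w\in A^*$, $[w]\subset A^{\mathbb{N}}$ is the set of sequences with prefix $w$. $U\subset A^{\mathbb{N}}$ is effectively open if $U=\bigcup_{w\in L}[w]$ for some r.e. $L\subset A^*$, and effectively closed sets are the complements of effectively open sets. A map $f\colon X\subset A^{\mathbb{N}}\to B^{\mathbb{N}}$ is computable if, uniformly in $w\in B^*$, there is an effectively open $U_w$ with $f^{-1}([w])=U_w\cap X$. Computable metric spaces. A computable metric space is $(X,d,\mathcal{S})$ where $(X,d)$ is a separable metric space, $\mathcal{S}=\{s_i: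 i\ge 0\}$ is dense in $X$, and there is an algorithm which on input $(i,j,n)$ outputs $r\in\mathbb{Q}$ with $|d(s_i,s_j)-r|\le 2^{-n}$. Basic balls are open balls centered at points of $\mathcal{S}$ with positive rational radius; fix a computable enumeration $(B_n)_{n\in\mathbb{N}}$ of them and put $U_I=\bigcup_{n\in I}B_n$ for $I\subset\mathbb{N}$. A compact set $K\subset X$ is recursively compact if there is an algorithm which, given a finite $I\subset\mathbb{N}$, halts if and only if $K\subset U_I$. For computable metric spaces $X,X'$ and $Y\subset X$, a map $f\colon Y\to X'$ is computable if there is an algorithm which, given $m$, enumerates a set $I_m$ with $f^{-1}(B'_m)=U_{I_m}\cap Y$, where $(B'_m)_m$ enumerates the basic balls of $X'$. An action $\Gamma\curvearrowright X$ of a finitely generated group (with $X$ a subset of $A^{\mathbb N}$, or a recursively compact subset of a computable metric space) is computable if for some (equivalently any) finite generating set $S$, for each $s\in S$ the map $x\mapsto sx$ is computable. An action $\Gamma\curvearrowright X$ of a finitely generated group on a compact metrizable space is an effective dynamical system (EDS) if it is topologically conjugate to a computable action on some recursively compact subset of a computable metric space (the conjugacy need not be computable). *)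

theory Defs
  imports
    "HOL-Analysis.Analysis"
    "HOL-Algebra.Group_Action"
    "HOL-Algebra.Generated_Groups"
    "HOL-Library.Nat_Bijection"
    "HOL-Library.Countable"
begin

section \<open>Turing machines\<close>

text \<open>
  Deterministic machines with one two-way infinite tape. States and tape symbols are initial
  segments of the natural numbers; state 0 is initial, symbol 0 is the blank and symbol 1 the mark
  used for unary input and output. A machine halts when its transition function is undefined.
\<close>

datatype head_move = Move_Left | Stay | Move_Right

record turing_machine =
  num_states :: nat
  num_symbols :: nat
  transition :: "nat \<Rightarrow> nat \<Rightarrow> (nat \<times> nat \<times> head_move) option"

definition wf_tm :: "turing_machine \<Rightarrow> bool" where
  "wf_tm M \<longleftrightarrow> num_states M \<ge> 1 \<and> num_symbols M \<ge> 2 \<and>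
     (\<forall>q<num_states M. \<forall>a<num_symbols M. \<forall>q' b m.
        transition M q a = Some (q', b, m) \<longrightarrow> q' < num_states M \<and> b < num_symbols M)"

text \<open>A configuration consists of the state, the tape contents and the position of the head.\<close>

type_synonym tm_config = "nat \<times> (int \<Rightarrow> nat) \<times> int"

fun move_head :: "head_move \<Rightarrow> int \<Rightarrow> int" where
  "move_head Move_Left h = h - 1"
| "move_head Stay h = h"
| "move_head Move_Right h = h + 1"

fun tm_halted :: "turing_machine \<Rightarrow> tm_config \<Rightarrow> bool" where
  "tm_halted M (q, t, h) \<longleftrightarrow> transition M q (t h) = None"

fun tm_step :: "turing_machine \<Rightarrow> tm_config \<Rightarrow> tm_config" where
  "tm_step M (q, t, h) =
     (case transition M q (t h) of
        None \<Rightarrow> (q, t, h)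
      | Some (q', b, m) \<Rightarrow> (q', t(h := b), move_head m h))"

definition tm_initial :: "nat \<Rightarrow> tm_config" where
  "tm_initial x = (0, (\<lambda>i. if 0 \<le> i \<and> i < int x then 1 else 0), 0)"

definition tm_halts_in :: "turing_machine \<Rightarrow> nat \<Rightarrow> tm_config \<Rightarrow> bool" where
  "tm_halts_in M x c \<longleftrightarrow> (\<exists>n. (tm_step M ^^ n) (tm_initial x) = c) \<and> tm_halted M c"

text \<open>The output is the block of marks that starts at the head and is followed by a blank.\<close>

fun tm_output :: "tm_config \<Rightarrow> nat \<Rightarrow> bool" where
  "tm_output (q, t, h) y \<longleftrightarrow> (\<forall>i<y. t (h + int i) = 1) \<and> t (h + int y) = 0"

definition computable_fun :: "(nat \<Rightarrow> nat) \<Rightarrow> bool" where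
  "computable_fun f \<longleftrightarrow>
     (\<exists>M. wf_tm M \<and> (\<forall>x. \<exists>c. tm_halts_in M x c \<and> tm_output c (f x)))"

definition recursively_enumerable :: "nat set \<Rightarrow> bool" where
  "recursively_enumerable A \<longleftrightarrow>
     (\<exists>M. wf_tm M \<and> (\<forall>x. x \<in> A \<longleftrightarrow> (\<exists>c. tm_halts_in M x c)))"

text \<open>
  Words over a \<open>k\<close>-letter alphabet are lists over \<open>{..<k}\<close>. Inputs that are not numbers are passed
  through the effective codings \<open>list_encode\<close>, \<open>prod_encode\<close>, \<open>set_encode\<close>.
\<close>

definition re_words :: "nat list set \<Rightarrow> bool" where
  "re_words L \<longleftrightarrow> recursively_enumerable (list_encode ` L)"

definition re_word_pairs :: "(nat list \<times> nat list) set \<Rightarrow> bool" where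
  "re_word_pairs P \<longleftrightarrow>
     recursively_enumerable ((\<lambda>(w, v). prod_encode (list_encode w, list_encode v)) ` P)"


section \<open>Finitely generated and recursively presented groups\<close>

definition finitely_generated_group :: "('g, 'm) monoid_scheme \<Rightarrow> bool" where
  "finitely_generated_group G \<longleftrightarrow> group G \<and>
     (\<exists>S. finite S \<and> S \<subseteq> carrier G \<and> generate G S = carrier G)"

definition word_value :: "('g, 'm) monoid_scheme \<Rightarrow> 'g list \<Rightarrow> nat list \<Rightarrow> 'g" where
  "word_value G ss w = foldr (\<lambda>i g. ss ! i \<otimes>\<^bsub>G\<^esub> g) w \<one>\<^bsub>G\<^esub>"

text \<open>The generating set is given by a list without repetitions, whose positions are the letters.\<close>

definition recursively_presented :: "('g, 'm) monoid_scheme \<Rightarrow> bool" where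
  "recursively_presented G \<longleftrightarrow>
     (\<exists>ss. distinct ss \<and> set ss \<subseteq> carrier G \<and> (\<forall>s\<in>set ss. inv\<^bsub>G\<^esub> s \<in> set ss) \<and>
        generate G (set ss) = carrier G \<and>
        re_words {w \<in> lists {..<length ss}. word_value G ss w = \<one>\<^bsub>G\<^esub>})"


section \<open>Actions by homeomorphisms\<close>

definition topological_action ::
    "('g, 'm) monoid_scheme \<Rightarrow> 'x topology \<Rightarrow> ('g \<Rightarrow> 'x \<Rightarrow> 'x) \<Rightarrow> bool" where
  "topological_action G X \<phi> \<longleftrightarrow>
     compact_space X \<and> metrizable_space X \<and> group_action G (topspace X) \<phi> \<and>
     (\<forall>g\<in>carrier G. homeomorphic_map X X (\<phi> g))"

definition factor_map ::
    "('g, 'm) monoid_scheme \<Rightarrow> 'x topology \<Rightarrow> ('g \<Rightarrow> 'x \<Rightarrow> 'x) \<Rightarrow>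
     'y topology \<Rightarrow> ('g \<Rightarrow> 'y \<Rightarrow> 'y) \<Rightarrow> ('x \<Rightarrow> 'y) \<Rightarrow> bool" where
  "factor_map G X \<phi> Y \<psi> f \<longleftrightarrow>
     continuous_map X Y f \<and> f ` topspace X = topspace Y \<and>
     (\<forall>g\<in>carrier G. \<forall>x\<in>topspace X. f (\<phi> g x) = \<psi> g (f x))"

text \<open>\<open>Y\<close> is a factor of \<open>X\<close>.\<close>

definition topological_factor ::
    "('g, 'm) monoid_scheme \<Rightarrow> 'x topology \<Rightarrow> ('g \<Rightarrow> 'x \<Rightarrow> 'x) \<Rightarrow>
     'y topology \<Rightarrow> ('g \<Rightarrow> 'y \<Rightarrow> 'y) \<Rightarrow> bool" where
  "topological_factor G X \<phi> Y \<psi> \<longleftrightarrow> (\<exists>f. factor_map G X \<phi> Y \<psi> f)"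

definition topologically_conjugate ::
    "('g, 'm) monoid_scheme \<Rightarrow> 'x topology \<Rightarrow> ('g \<Rightarrow> 'x \<Rightarrow> 'x) \<Rightarrow>
     'y topology \<Rightarrow> ('g \<Rightarrow> 'y \<Rightarrow> 'y) \<Rightarrow> bool" where
  "topologically_conjugate G X \<phi> Y \<psi> \<longleftrightarrow>
     (\<exists>f. factor_map G X \<phi> Y \<psi> f \<and> homeomorphic_map X Y f)"

text \<open>
  In compact metrizable spaces all the usual dimensions agree; \<open>dim_le\<close> is the small inductive one.
  The empty space, of dimension -1, is included.
\<close>

definition zero_dimensional :: "'x topology \<Rightarrow> bool" where
  "zero_dimensional X \<longleftrightarrow> compact_space X \<and> metrizable_space X \<and> X dim_le 0"


section \<open>Computability on Cantor spaces\<close>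

definition cantor_space :: "nat \<Rightarrow> (nat \<Rightarrow> nat) topology" where
  "cantor_space k = product_topology (\<lambda>_. discrete_topology {..<k}) UNIV"

definition cylinder :: "nat \<Rightarrow> nat list \<Rightarrow> (nat \<Rightarrow> nat) set" where
  "cylinder k w = {x \<in> topspace (cantor_space k). \<forall>i<length w. x i = w ! i}"

definition effectively_open :: "nat \<Rightarrow> (nat \<Rightarrow> nat) set \<Rightarrow> bool" where
  "effectively_open k U \<longleftrightarrow>
     (\<exists>L \<subseteq> lists {..<k}. re_words L \<and> U = (\<Union>w\<in>L. cylinder k w))"

definition effectively_closed :: "nat \<Rightarrow> (nat \<Rightarrow> nat) set \<Rightarrow> bool" where
  "effectively_closed k C \<longleftrightarrow>
     C \<subseteq> topspace (cantor_space k) \<and> effectively_open k (topspace (cantor_space k) - C)"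

text \<open>
  Uniformity in \<open>w\<close>: a single recursively enumerable set \<open>P\<close> of pairs provides, for every \<open>w\<close>, the
  words \<open>v\<close> with \<open>(w, v) \<in> P\<close> whose cylinders make up the effectively open set \<open>U\<^sub>w\<close>.
\<close>

definition computable_cantor_map ::
    "nat \<Rightarrow> (nat \<Rightarrow> nat) set \<Rightarrow> nat \<Rightarrow> ((nat \<Rightarrow> nat) \<Rightarrow> (nat \<Rightarrow> nat)) \<Rightarrow> bool" where
  "computable_cantor_map k X l f \<longleftrightarrow>
     f ` X \<subseteq> topspace (cantor_space l) \<and>
     (\<exists>P \<subseteq> lists {..<l} \<times> lists {..<k}. re_word_pairs P \<and>
        (\<forall>w\<in>lists {..<l}.
           {x \<in> X. f x \<in> cylinder l w} = (\<Union>v\<in>{v. (w, v) \<in> P}. cylinder k v) \<inter> X))"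

definition computable_cantor_action ::
    "('g, 'm) monoid_scheme \<Rightarrow> nat \<Rightarrow> (nat \<Rightarrow> nat) set \<Rightarrow>
     ('g \<Rightarrow> (nat \<Rightarrow> nat) \<Rightarrow> (nat \<Rightarrow> nat)) \<Rightarrow> bool" where
  "computable_cantor_action G k X \<phi> \<longleftrightarrow>
     topological_action G (subtopology (cantor_space k) X) \<phi> \<and>
     (\<exists>S. finite S \<and> S \<subseteq> carrier G \<and> generate G S = carrier G \<and>
        (\<forall>s\<in>S. computable_cantor_map k X k (\<phi> s)))"


section \<open>Computability on metric spaces\<close>

text \<open>Rational outputs are given by codes with respect to \<open>nat_to_rat_surj\<close>.\<close>

definition computable_metric_space :: "'z metric \<Rightarrow> (nat \<Rightarrow> 'z) \<Rightarrow> bool" where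
  "computable_metric_space Z s \<longleftrightarrow>
     range s \<subseteq> mspace Z \<and> mtopology_of Z closure_of range s = mspace Z \<and>
     (\<exists>r. computable_fun r \<and>
        (\<forall>i j n. \<bar>mdist Z (s i) (s j) -
            of_rat (nat_to_rat_surj (r (prod_encode (i, prod_encode (j, n)))))\<bar> \<le> 1 / 2 ^ n))"

text \<open>The \<open>n\<close>-th basic ball, where \<open>n\<close> codes the triple \<open>(i, a, b)\<close>, has centre \<open>s i\<close> and radius
  \<open>(a + 1) / (b + 1)\<close>.\<close>

definition basic_ball :: "'z metric \<Rightarrow> (nat \<Rightarrow> 'z) \<Rightarrow> nat \<Rightarrow> 'z set" where
  "basic_ball Z s n =
     (let (i, c) = prod_decode n; (a, b) = prod_decode c
      in Metric_space.mball (mspace Z) (mdist Z) (s i) (real (Suc a) / real (Suc b)))"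

definition basic_union :: "'z metric \<Rightarrow> (nat \<Rightarrow> 'z) \<Rightarrow> nat set \<Rightarrow> 'z set" where
  "basic_union Z s I = (\<Union>n\<in>I. basic_ball Z s n)"

definition recursively_compact :: "'z metric \<Rightarrow> (nat \<Rightarrow> 'z) \<Rightarrow> 'z set \<Rightarrow> bool" where
  "recursively_compact Z s K \<longleftrightarrow>
     compactin (mtopology_of Z) K \<and>
     recursively_enumerable (set_encode ` {I. finite I \<and> K \<subseteq> basic_union Z s I})"

definition computable_metric_map ::
    "'z metric \<Rightarrow> (nat \<Rightarrow> 'z) \<Rightarrow> 'z set \<Rightarrow> 'y metric \<Rightarrow> (nat \<Rightarrow> 'y) \<Rightarrow> ('z \<Rightarrow> 'y) \<Rightarrow> bool" where
  "computable_metric_map Z s Y Z' s' f \<longleftrightarrow>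
     f ` Y \<subseteq> mspace Z' \<and>
     (\<exists>I :: nat \<Rightarrow> nat set.
        recursively_enumerable {prod_encode (m, n) | m n. n \<in> I m} \<and>
        (\<forall>m. {y \<in> Y. f y \<in> basic_ball Z' s' m} = basic_union Z s (I m) \<inter> Y))"

definition computable_metric_action ::
    "('g, 'm) monoid_scheme \<Rightarrow> 'z metric \<Rightarrow> (nat \<Rightarrow> 'z) \<Rightarrow> 'z set \<Rightarrow> ('g \<Rightarrow> 'z \<Rightarrow> 'z) \<Rightarrow> bool" where
  "computable_metric_action G Z s K \<phi> \<longleftrightarrow>
     topological_action G (subtopology (mtopology_of Z) K) \<phi> \<and>
     (\<exists>S. finite S \<and> S \<subseteq> carrier G \<and> generate G S = carrier G \<and>
        (\<forall>g\<in>S. computable_metric_map Z s K Z s (\<phi> g)))"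

text \<open>
  HOL cannot quantify over the type of the points of the computable metric space, so this type is a
  parameter. A theorem assuming this predicate is implicitly universal over the type, which
  amounts to assuming the existence of a computable metric space on any type whatsoever.
\<close>

definition effective_dynamical_system ::
    "'z itself \<Rightarrow> ('g, 'm) monoid_scheme \<Rightarrow> 'x topology \<Rightarrow> ('g \<Rightarrow> 'x \<Rightarrow> 'x) \<Rightarrow> bool" where
  "effective_dynamical_system _ G X \<phi> \<longleftrightarrow>
     topological_action G X \<phi> \<and>
     (\<exists>(Z :: 'z metric) s K \<psi>.
        computable_metric_space Z s \<and> recursively_compact Z s K \<and>
        computable_metric_action G Z s K \<psi> \<and>
        topologically_conjugate G X \<phi> (subtopology (mtopology_of Z) K) \<psi>)"

end

theory Submission
  imports Defs
begin

text \<open>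
  Two formally disjoint basic balls of the metric space give one bit of information about a point of
  \<open>K\<close>, namely the name of one of the two balls that the point avoids. Such pairs of balls are
  recursively enumerable and separate points, so a point is determined by a compatible choice of
  bits, and every point admits one. A point of the extension records these bits for all translates
  \<open>g \<cdot> x\<close>, indexed by words representing \<open>g\<close>. Group elements act by right multiplication of the words,
  which merely reindexes coordinates. The bits of \<open>z\<close> fail to code an orbit only if two words for the
  same element carry different bits, which is semidecidable since the group is recursively presented,
  or if for some generator \<open>s\<close> and word \<open>w\<close> no point \<open>x\<close> of \<open>K\<close> is compatible with the bits at \<open>w\<close> while
  \<open>s \<cdot> x\<close> is compatible with those at \<open>s w\<close>. The latter says that \<open>K\<close> is covered by the balls named by
  these bits and by preimages of such balls under \<open>s\<close>, which is semidecidable by recursive compactness.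

  Recursive enumerability is handled through primitive recursive functions on coded pairs: these are
  compiled to Turing machines by way of register programs, and conversely runs of Turing machines are
  simulated primitive recursively.
\<close>

section \<open>Register programs\<close>

text \<open>The word problem of the group need not be decidable, so coordinates cannot be indexed by
  group elements. With words as indices, the agreement of words for one element becomes a closed
  condition whose violations can be enumerated. The bits are not a function of the point: a point
  outside both balls of a pair may receive either value, and a pair that is never enumerated carries
  a bit that no point constrains. So the extension collects all admissible choices instead of making
  one, no effective choice of bits is needed, and the factor map is only shown to be continuous. Two
  generating sets occur: that of the presentation makes the shift computable, that of the given
  action controls compatibility along edges. Primitive recursive predicates keep partial functions
  out of the argument: a semidecidable predicate is one unbounded search over a total predicate, and
  conjunctions, existential and bounded universal quantifiers are absorbed by coding several
  witnesses or bounds into one number.\<close>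

datatype com = Inc nat | Dec nat | Seq com com (infixr ";;" 60) | While nat com

inductive exec :: "com \<Rightarrow> (nat \<Rightarrow> nat) \<Rightarrow> (nat \<Rightarrow> nat) \<Rightarrow> bool" where
  exec_Inc: "exec (Inc r) s (s(r := Suc (s r)))"
| exec_Dec: "exec (Dec r) s (s(r := s r - 1))"
| exec_Seq: "exec c s s' \<Longrightarrow> exec d s' s'' \<Longrightarrow> exec (c ;; d) s s''"
| exec_While_0: "s r = 0 \<Longrightarrow> exec (While r c) s s"
| exec_While_Suc: "s r > 0 \<Longrightarrow> exec c s s' \<Longrightarrow> exec (While r c) s' s'' \<Longrightarrow> exec (While r c) s s''"

fun registers :: "com \<Rightarrow> nat set" where
  "registers (Inc r) = {r}"
| "registers (Dec r) = {r}"
| "registers (c ;; d) = registers c \<union> registers d"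
| "registers (While r c) = insert r (registers c)"

text \<open>
  A program on \<open>k\<close> registers runs on a tape whose symbols are bit vectors: bit \<open>r\<close> of cell \<open>j\<close> is
  set iff \<open>j\<close> is less than the contents of register \<open>r\<close>, and bit \<open>k\<close> marks the origin.
  The initial tape for input \<open>x\<close> then holds \<open>x\<close> in register \<open>0\<close>, up to the mark.
\<close>

definition register_tape :: "nat \<Rightarrow> (nat \<Rightarrow> nat) \<Rightarrow> int \<Rightarrow> nat" where
  "register_tape k s j =
     (if j < 0 then 0 else set_encode ({r. r < k \<and> j < int (s r)} \<union> (if j = 0 then {k} else {})))"

section \<open>Compilation of register programs to Turing machines\<close>

type_synonym tm_rule = "nat \<Rightarrow> nat \<times> nat \<times> head_move"

fun code_length :: "com \<Rightarrow> nat" where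
  "code_length (Inc r) = 2"
| "code_length (Dec r) = 3"
| "code_length (c ;; d) = code_length c + code_length d"
| "code_length (While r c) = code_length c + 2"

text \<open>Every block is entered at state \<open>q\<close> and left at state
  \<open>q + code_length c\<close>, both times with the head on the origin, so blocks can be
  concatenated. Bit \<open>k\<close> stops the scans to the left; in \<open>Dec\<close> it also
  detects an empty register.\<close>

fun code :: "nat \<Rightarrow> com \<Rightarrow> nat \<Rightarrow> tm_rule list" where
  "code k (Inc r) q =
     [\<lambda>a. if r \<in> set_decode a then (q, a, Move_Right)
          else (q + 1, set_encode (insert r (set_decode a)), Stay),
      \<lambda>a. if k \<in> set_decode a then (q + 2, a, Stay) else (q + 1, a, Move_Left)]"
| "code k (Dec r) q =
     [\<lambda>a. if r \<in> set_decode a then (q, a, Move_Right)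
          else if k \<in> set_decode a then (q + 3, a, Stay) else (q + 1, a, Move_Left),
      \<lambda>a. (q + 2, set_encode (set_decode a - {r}), Stay),
      \<lambda>a. if k \<in> set_decode a then (q + 3, a, Stay) else (q + 2, a, Move_Left)]"
| "code k (c ;; d) q = code k c q @ code k d (q + code_length c)"
| "code k (While r c) q =
     [\<lambda>a. if r \<in> set_decode a then (q + 1, a, Stay) else (q + code_length c + 2, a, Stay)] @
     code k c (q + 1) @ [\<lambda>a. (q, a, Stay)]"

lemma length_code [simp]: "length (code k c q) = code_length c"
  by (induction c arbitrary: q) auto

text \<open>The caps by \<open>min\<close> make the machine well-formed for every rule list. State
  \<open>length P\<close> has no rule and is the halting state.\<close>

definition machine :: "nat \<Rightarrow> tm_rule list \<Rightarrow> turing_machine" where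
  "machine k P = \<lparr>num_states = Suc (length P), num_symbols = Suc (set_encode {..k}),
     transition = (\<lambda>q a. if q < length P
       then let (q', b, m) = (P ! q) a in Some (min q' (length P), min b (set_encode {..k}), m)
       else None)\<rparr>"

lemma set_encode_mono: "finite B \<Longrightarrow> A \<subseteq> B \<Longrightarrow> set_encode A \<le> set_encode B"
  unfolding set_encode_def by (intro sum_mono2) auto

lemma wf_tm_machine: "wf_tm (machine k P)"
proof -
  have "set_encode {0} \<le> set_encode {..k}" by (intro set_encode_mono) auto
  then show ?thesis
    by (auto simp: wf_tm_def machine_def Let_def split: prod.splits if_splits)
qed

lemma tm_halted_machine: "tm_halted (machine k P) (q, t, h) \<longleftrightarrow> length P \<le> q"
  by (auto simp: machine_def Let_def split: prod.splits)

lemma tm_step_machine: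
  assumes "q < length P" "(P ! q) (t h) = (q', b, m)" "q' \<le> length P" "b \<le> set_encode {..k}"
  shows "tm_step (machine k P) (q, t, h) = (q', t(h := b), move_head m h)"
  using assms by (simp add: machine_def)

definition reaches :: "turing_machine \<Rightarrow> tm_config \<Rightarrow> tm_config \<Rightarrow> bool" where
  "reaches M c c' \<longleftrightarrow> (\<exists>n. (tm_step M ^^ n) c = c')"

lemma reaches_refl [simp]: "reaches M c c"
  unfolding reaches_def by (rule exI[of _ 0]) simp

lemma reaches_trans [trans]: "reaches M c d \<Longrightarrow> reaches M d e \<Longrightarrow> reaches M c e"
  unfolding reaches_def by (metis comp_apply funpow_add)

lemma reaches_step: "tm_step M c = d \<Longrightarrow> reaches M c d"
  unfolding reaches_def by (rule exI[of _ 1]) simp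

lemma register_tape_bound: "register_tape k s j \<le> set_encode {..k}"
  unfolding register_tape_def by (auto simp del: set_encode_insert intro!: set_encode_mono)

lemma set_decode_register_tape:
  "j \<ge> 0 \<Longrightarrow> set_decode (register_tape k s j) = {r. r < k \<and> j < int (s r)} \<union> (if j = 0 then {k} else {})"
  by (simp add: register_tape_def)

lemma mem_register_tape:
  "0 \<le> j \<Longrightarrow> r < k \<Longrightarrow> r \<in> set_decode (register_tape k s j) \<longleftrightarrow> j < int (s r)"
  "0 \<le> j \<Longrightarrow> k \<in> set_decode (register_tape k s j) \<longleftrightarrow> j = 0"
  by (auto simp: set_decode_register_tape)

lemma register_tape_Suc:
  assumes "r < k"
  shows "(register_tape k s)(int (s r) := set_encode (insert r (set_decode (register_tape k s (int (s r))))))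
    = register_tape k (s(r := Suc (s r)))"
proof (rule ext)
  fix j
  have "insert r (set_decode (register_tape k s j)) = set_decode (register_tape k (s(r := Suc (s r))) j)"
    if "j = int (s r)"
    using assms that by (auto simp: set_decode_register_tape)
  moreover have "register_tape k s j = register_tape k (s(r := Suc (s r))) j" if "j \<noteq> int (s r)"
  proof -
    have "{r'. r' < k \<and> j < int (s r')} = {r'. r' < k \<and> j < int ((s(r := Suc (s r))) r')}"
      using that by auto
    then show ?thesis unfolding register_tape_def by presburger
  qed
  ultimately show "((register_tape k s)(int (s r) := set_encode (insert r (set_decode (register_tape k s (int (s r))))))) j
    = register_tape k (s(r := Suc (s r))) j"
    by (cases "j = int (s r)") (simp_all del: set_encode_insert)
qed

lemma register_tape_pred:
  assumes "r < k" "s r > 0"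
  shows "(register_tape k s)(int (s r) - 1 := set_encode (set_decode (register_tape k s (int (s r) - 1)) - {r}))
    = register_tape k (s(r := s r - 1))"
proof (rule ext)
  fix j
  have "set_decode (register_tape k s j) - {r} = set_decode (register_tape k (s(r := s r - 1)) j)"
    if "j = int (s r) - 1"
    using assms that by (auto simp: set_decode_register_tape)
  moreover have "register_tape k s j = register_tape k (s(r := s r - 1)) j" if "j \<noteq> int (s r) - 1"
  proof -
    have "{r'. r' < k \<and> j < int (s r')} = {r'. r' < k \<and> j < int ((s(r := s r - 1)) r')}"
      using that assms by auto
    then show ?thesis unfolding register_tape_def by presburger
  qed
  ultimately show "((register_tape k s)(int (s r) - 1 := set_encode (set_decode (register_tape k s (int (s r) - 1)) - {r}))) j
    = register_tape k (s(r := s r - 1)) j"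
    by (cases "j = int (s r) - 1") (simp_all del: set_encode_insert)
qed

context
  fixes k :: nat and P :: "tm_rule list"
begin

lemma scan_right:
  assumes "q < length P" "r < k" "\<And>a. r \<in> set_decode a \<Longrightarrow> (P ! q) a = (q, a, Move_Right)" "j \<le> s r"
  shows "reaches (machine k P) (q, register_tape k s, 0) (q, register_tape k s, int j)"
  using assms(4)
proof (induction j)
  case (Suc j)
  have "tm_step (machine k P) (q, register_tape k s, int j)
      = (q, (register_tape k s)(int j := register_tape k s (int j)), move_head Move_Right (int j))"
    using Suc.prems assms by (intro tm_step_machine assms(3)) (auto simp: mem_register_tape register_tape_bound)
  then have "reaches (machine k P) (q, register_tape k s, int j) (q, register_tape k s, int (Suc j))"
    by (intro reaches_step) (simp add: algebra_simps)
  then show ?case using Suc by (meson Suc_leD reaches_trans)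
qed simp

lemma scan_left:
  assumes "q < length P" "q' \<le> length P"
    "\<And>a. (P ! q) a = (if k \<in> set_decode a then (q', a, Stay) else (q, a, Move_Left))"
  shows "reaches (machine k P) (q, register_tape k s, int j) (q', register_tape k s, 0)"
proof (induction j)
  case 0
  have "tm_step (machine k P) (q, register_tape k s, 0)
      = (q', (register_tape k s)(0 := register_tape k s 0), move_head Stay 0)"
    using assms by (intro tm_step_machine) (auto simp: mem_register_tape register_tape_bound)
  then show ?case by (intro reaches_step) simp
next
  case (Suc j)
  have "tm_step (machine k P) (q, register_tape k s, int (Suc j))
      = (q, (register_tape k s)(int (Suc j) := register_tape k s (int (Suc j))), move_head Move_Left (int (Suc j)))"
    using assms by (intro tm_step_machine) (auto simp: mem_register_tape register_tape_bound)
  then have "reaches (machine k P) (q, register_tape k s, int (Suc j)) (q, register_tape k s, int j)"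
    by (intro reaches_step) simp
  then show ?case using Suc by (meson reaches_trans)
qed

lemma reaches_keep:
  assumes "(P ! q) (register_tape k s h) = (q', register_tape k s h, m)" "q < length P" "q' \<le> length P"
    "move_head m h = h'"
  shows "reaches (machine k P) (q, register_tape k s, h) (q', register_tape k s, h')"
  using tm_step_machine[of q P "register_tape k s" h q' "register_tape k s h" m k] assms
  by (intro reaches_step) (simp add: register_tape_bound)

text \<open>The block may sit anywhere in \<open>P\<close>, because the induction passes to
  sub-blocks of one fixed machine. It runs over the execution and not over the program, since the
  rest of a loop is the loop itself.\<close>

lemma reaches_exec:
  assumes "exec c s s'" "registers c \<subseteq> {..<k}" "P = P1 @ code k c (length P1) @ P2"
  shows "reaches (machine k P) (length P1, register_tape k s, 0)
           (length P1 + code_length c, register_tape k s', 0)"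
  using assms
proof (induction arbitrary: P1 P2 rule: exec.induct)
  case (exec_Inc r s)
  let ?q = "length P1"
  have r: "r < k" using exec_Inc by simp
  have q0: "P ! ?q = (\<lambda>a. if r \<in> set_decode a then (?q, a, Move_Right)
          else (?q + 1, set_encode (insert r (set_decode a)), Stay))"
    and q1: "P ! Suc ?q = (\<lambda>a. if k \<in> set_decode a then (?q + 2, a, Stay) else (?q + 1, a, Move_Left))"
    and len: "?q + 2 \<le> length P"
    using exec_Inc(2) by (auto simp: nth_append)
  have "reaches (machine k P) (?q, register_tape k s, 0) (?q, register_tape k s, int (s r))"
    using len r by (intro scan_right) (auto simp: q0)
  also have "reaches (machine k P) (?q, register_tape k s, int (s r))
      (Suc ?q, register_tape k (s(r := Suc (s r))), int (s r))"
  proof (rule reaches_step)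
    let ?b = "set_encode (insert r (set_decode (register_tape k s (int (s r)))))"
    have "r \<notin> set_decode (register_tape k s (int (s r)))"
      using r by (simp add: mem_register_tape)
    then have "(P ! ?q) (register_tape k s (int (s r))) = (Suc ?q, ?b, Stay)"
      by (simp add: q0)
    moreover have "?b \<le> set_encode {..k}"
      using r by (intro set_encode_mono) (auto simp: set_decode_register_tape split: if_splits)
    ultimately show "tm_step (machine k P) (?q, register_tape k s, int (s r)) =
      (Suc ?q, register_tape k (s(r := Suc (s r))), int (s r))"
      using len tm_step_machine register_tape_Suc[OF r] by simp
  qed
  also have "reaches (machine k P) \<dots> (?q + 2, register_tape k (s(r := Suc (s r))), 0)"
    using len by (intro scan_left) (auto simp: q1)
  finally show ?case by (simp add: fun_upd_def)
next
  case (exec_Dec r s)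
  let ?q = "length P1"
  have r: "r < k" using exec_Dec by simp
  have q0: "P ! ?q = (\<lambda>a. if r \<in> set_decode a then (?q, a, Move_Right)
          else if k \<in> set_decode a then (?q + 3, a, Stay) else (?q + 1, a, Move_Left))"
    and q1: "P ! Suc ?q = (\<lambda>a. (?q + 2, set_encode (set_decode a - {r}), Stay))"
    and q2: "P ! Suc (Suc ?q) = (\<lambda>a. if k \<in> set_decode a then (?q + 3, a, Stay) else (?q + 2, a, Move_Left))"
    and len: "?q + 3 \<le> length P"
    using exec_Dec(2) by (auto simp: nth_append)
  have "reaches (machine k P) (?q, register_tape k s, 0) (?q, register_tape k s, int (s r))"
    using len r by (intro scan_right) (auto simp: q0)
  also have "reaches (machine k P) (?q, register_tape k s, int (s r))
      (?q + 3, register_tape k (s(r := s r - 1)), 0)"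
  proof (cases "s r = 0")
    case True
    have "s(r := s r - 1) = s" using True by auto
    then have *: "register_tape k (s(r := s r - 1)) = register_tape k s" by simp
    show ?thesis unfolding *
      using True len r by (intro reaches_keep[where m=Stay]) (simp_all add: q0 mem_register_tape)
  next
    case False
    have "reaches (machine k P) (?q, register_tape k s, int (s r)) (Suc ?q, register_tape k s, int (s r) - 1)"
      using False len r by (intro reaches_keep[where m=Move_Left]) (simp_all add: q0 mem_register_tape)
    also have "reaches (machine k P) \<dots>
      (Suc (Suc ?q), register_tape k (s(r := s r - 1)), int (s r) - 1)"
    proof (rule reaches_step)
      have "set_encode (set_decode (register_tape k s (int (s r) - 1)) - {r}) \<le> set_encode {..k}"
        using False by (intro set_encode_mono) (auto simp: set_decode_register_tape split: if_splits)
      then show "tm_step (machine k P) (Suc ?q, register_tape k s, int (s r) - 1) =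
        (Suc (Suc ?q), register_tape k (s(r := s r - 1)), int (s r) - 1)"
        using False len tm_step_machine[of "Suc ?q" P "register_tape k s" "int (s r) - 1"] register_tape_pred[of r k s] r
        by (simp add: q1)
    qed
    also have "reaches (machine k P) \<dots> (?q + 3, register_tape k (s(r := s r - 1)), 0)"
      using len scan_left[of "Suc (Suc ?q)" "?q + 3" "s(r := s r - 1)" "s r - 1"] False
      by (auto simp: q2 of_nat_diff)
    finally show ?thesis .
  qed
  finally show ?case by (simp add: fun_upd_def)
next
  case (exec_Seq c s s' d s'')
  have "reaches (machine k P) (length P1, register_tape k s, 0)
      (length P1 + code_length c, register_tape k s', 0)"
    by (rule exec_Seq.IH(1)) (use exec_Seq.prems in auto)
  also have "reaches (machine k P) (length (P1 @ code k c (length P1)), register_tape k s', 0)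
      (length (P1 @ code k c (length P1)) + code_length d, register_tape k s'', 0)"
    by (rule exec_Seq.IH(2)) (use exec_Seq.prems in auto)
  then have "reaches (machine k P) (length P1 + code_length c, register_tape k s', 0)
      (length P1 + code_length c + code_length d, register_tape k s'', 0)" by simp
  finally show ?case by (simp add: add.assoc)
next
  case (exec_While_0 s r c)
  then show ?case
    by (intro reaches_keep[where m=Stay]) (simp_all add: nth_append mem_register_tape)
next
  case (exec_While_Suc s r c s' s'')
  have "reaches (machine k P) (length P1, register_tape k s, 0) (Suc (length P1), register_tape k s, 0)"
    using exec_While_Suc
    by (intro reaches_keep[where m=Stay]) (simp_all add: nth_append mem_register_tape)
  \<comment> \<open>The loop test joins the prefix, so that the body starts at state
    \<open>Suc (length P1)\<close>.\<close>
  also have "reaches (machine k P) (length (P1 @ [(code k (While r c) (length P1)) ! 0]), register_tape k s, 0)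
    (length (P1 @ [(code k (While r c) (length P1)) ! 0]) + code_length c, register_tape k s', 0)"
    by (rule exec_While_Suc.IH(1)) (use exec_While_Suc.prems in auto)
  then have "reaches (machine k P) (Suc (length P1), register_tape k s, 0)
    (Suc (length P1) + code_length c, register_tape k s', 0)" by simp
  also have "reaches (machine k P) (Suc (length P1) + code_length c, register_tape k s', 0)
    (length P1, register_tape k s', 0)"
    using exec_While_Suc.prems
    by (intro reaches_keep[where m=Stay]) (simp_all add: nth_append)
  also have "reaches (machine k P) \<dots> (length P1 + code_length (While r c), register_tape k s'', 0)"
    by (rule exec_While_Suc.IH(2)) (use exec_While_Suc.prems in auto)
  finally show ?case .
qed

end

section \<open>Primitive recursive functions\<close>

definition pfst :: "nat \<Rightarrow> nat" where "pfst x = fst (prod_decode x)"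
definition psnd :: "nat \<Rightarrow> nat" where "psnd x = snd (prod_decode x)"
definition pair :: "nat \<Rightarrow> nat \<Rightarrow> nat" where "pair x y = prod_encode (x, y)"

lemma pfst_pair [simp]: "pfst (pair x y) = x"
  and psnd_pair [simp]: "psnd (pair x y) = y"
  and pair_pfst_psnd [simp]: "pair (pfst x) (psnd x) = x"
  and pair_eq_iff [simp]: "pair x y = pair x' y' \<longleftrightarrow> x = x' \<and> y = y'"
  by (simp_all add: pfst_def psnd_def pair_def)

text \<open>Pairs replace several arguments, and iteration, which a loop with a counter performs
  directly, replaces recursion; \<open>pr_rec\<close> recovers the usual schema.\<close>

inductive pr :: "(nat \<Rightarrow> nat) \<Rightarrow> bool" where
  pr_zero: "pr (\<lambda>_. 0)"
| pr_Suc_basic: "pr Suc"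
| pr_pfst_basic: "pr pfst"
| pr_psnd_basic: "pr psnd"
| pr_pair: "pr f \<Longrightarrow> pr g \<Longrightarrow> pr (\<lambda>x. pair (f x) (g x))"
| pr_comp: "pr f \<Longrightarrow> pr g \<Longrightarrow> pr (\<lambda>x. f (g x))"
| pr_funpow_basic: "pr f \<Longrightarrow> pr (\<lambda>x. (f ^^ psnd x) (pfst x))"

text \<open>Registers above \<open>b\<close> are work space, zero before and after the run, and
  those below \<open>b\<close> keep their values. A caller can therefore store data below the base
  of a subprogram.\<close>

definition implements :: "(nat \<Rightarrow> com) \<Rightarrow> (nat \<Rightarrow> nat) \<Rightarrow> bool" where
  "implements c f \<longleftrightarrow> (\<forall>b s. (\<forall>r>b. s r = 0) \<longrightarrow> exec (c b) s (s(b := f (s b))))"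

lemma implementsD:
  "implements c f \<Longrightarrow> (\<And>r. r > b \<Longrightarrow> s r = 0) \<Longrightarrow> s' = s(b := f (s b)) \<Longrightarrow> exec (c b) s s'"
  by (auto simp: implements_def)

lemma exec_DecI: "s' = s(r := s r - 1) \<Longrightarrow> exec (Dec r) s s'"
  using exec_Dec by auto

text \<open>Here and below the final store is fixed by an equation, so that \<open>exec_Seq\<close>
  can be chained with unknown intermediate stores and one equation between functions remains at the
  end.\<close>

lemma exec_move:
  assumes "d \<noteq> r" "s' = s(d := s d + s r, r := 0)"
  shows "exec (While r (Dec r ;; Inc d)) s s'"
  using assms
proof (induction "s r" arbitrary: s s')
  case 0
  then have "s' = s" by auto
  then show ?case using 0 exec_While_0 by auto
next
  case (Suc n)
  show ?case
    by (rule exec_While_Suc, use Suc in simp, rule exec_Seq, rule exec_Dec, rule exec_Inc, rule Suc(1))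
      (use Suc(2-) in \<open>auto simp: fun_eq_iff\<close>)
qed

lemma exec_move2:
  assumes "d \<noteq> r" "e \<noteq> r" "d \<noteq> e" "s' = s(d := s d + s r, e := s e + s r, r := 0)"
  shows "exec (While r (Dec r ;; Inc d ;; Inc e)) s s'"
  using assms
proof (induction "s r" arbitrary: s s')
  case 0
  then have "s' = s" by auto
  then show ?case using 0 exec_While_0 by auto
next
  case (Suc n)
  show ?case
    by (rule exec_While_Suc, use Suc in simp, rule exec_Seq, rule exec_Dec, rule exec_Seq, rule exec_Inc,
        rule exec_Inc, rule Suc(1))
      (use Suc(2-) in \<open>auto simp: fun_eq_iff\<close>)
qed

lemma exec_clear: "s' = s(r := 0) \<Longrightarrow> exec (While r (Dec r)) s s'"
proof (induction "s r" arbitrary: s s')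
  case 0
  then have "s' = s" by auto
  then show ?case using 0 exec_While_0 by auto
next
  case (Suc n)
  show ?case
    by (rule exec_While_Suc, use Suc in simp, rule exec_Dec, rule Suc(1))
      (use Suc(2-) in \<open>auto simp: fun_eq_iff\<close>)
qed

abbreviation "move_reg r d \<equiv> While r (Dec r ;; Inc d)"
abbreviation "move_reg2 r d e \<equiv> While r (Dec r ;; Inc d ;; Inc e)"

text \<open>Uses \<open>prod_encode (u, v) = triangle (u + v) + u\<close>.\<close>

definition encode_prog :: "nat \<Rightarrow> com" where
  "encode_prog b = move_reg2 (b+1) b (b+3) ;; move_reg (b+2) (b+3) ;;
     While (b+3) (move_reg2 (b+3) b (b+4) ;; move_reg (b+4) (b+3) ;; Dec (b+3))"

text \<open>Each round adds the counter \<open>b+3\<close> to \<open>b\<close>, restores it from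
  \<open>b+4\<close> and decrements it; the sum \<open>n + (n - 1) + ... + 1\<close> is
  \<open>triangle n\<close>.\<close>

lemma exec_triangle:
  assumes "s (b+4) = 0" "s' = s(b := s b + triangle (s (b+3)), b+3 := 0)"
  shows "exec (While (b+3) (move_reg2 (b+3) b (b+4) ;; move_reg (b+4) (b+3) ;; Dec (b+3))) s s'"
  using assms
proof (induction "s (b+3)" arbitrary: s s')
  case 0
  then have "s' = s" by auto
  then show ?case using 0 exec_While_0 by auto
next
  case (Suc n)
  show ?case
    by (rule exec_While_Suc, use Suc in simp, rule exec_Seq, rule exec_move2, simp, simp, simp, rule refl,
        rule exec_Seq, rule exec_move, simp, rule refl, rule exec_Dec, rule Suc(1))
      (use Suc(2-) in \<open>auto simp: fun_eq_iff simp flip: Suc(2)\<close>)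
qed

lemma exec_encode_prog:
  assumes "s b = 0" "s (b+3) = 0" "s (b+4) = 0" "s' = s(b := pair (s (b+1)) (s (b+2)), b+1 := 0, b+2 := 0)"
  shows "exec (encode_prog b) s s'"
  unfolding encode_prog_def
  by (rule exec_Seq, rule exec_move2, simp, simp, simp, rule refl,
      rule exec_Seq, rule exec_move, simp, rule refl, rule exec_triangle)
    (use assms in \<open>auto simp: fun_eq_iff pair_def prod_encode_def\<close>)

text \<open>
  Walks along the enumeration of pairs, starting from \<open>(0, 0)\<close> in registers \<open>b + 1\<close>, \<open>b + 2\<close>;
  register \<open>b + 3\<close> flags the end of a diagonal.
\<close>

definition next_pair_prog :: "nat \<Rightarrow> com" where
  "next_pair_prog b =
     Inc (b+3) ;;
     While (b+2) (Dec (b+2) ;; Inc (b+1) ;; Dec (b+3) ;; move_reg (b+2) (b+4)) ;; move_reg (b+4) (b+2) ;;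
     While (b+3) (Dec (b+3) ;; Inc (b+2) ;; move_reg (b+1) (b+2))"

definition decode_prog :: "nat \<Rightarrow> com" where
  "decode_prog b = While b (Dec b ;; next_pair_prog b)"

text \<open>The successor rule of the enumeration by diagonals, which \<open>next_pair_prog\<close>
  follows.\<close>

lemma triangle_pair: "pair u 0 + 1 = pair 0 (Suc u)" "pair u (Suc v) + 1 = pair (Suc u) v"
  by (simp_all add: pair_def prod_encode_def)

lemma exec_While_0': "s r = 0 \<Longrightarrow> s' = s \<Longrightarrow> exec (While r c) s s'"
  by (simp add: exec_While_0)

lemma exec_While_once: "s r > 0 \<Longrightarrow> exec c s s' \<Longrightarrow> s' r = 0 \<Longrightarrow> exec (While r c) s s'"
  by (simp add: exec_While_0 exec_While_Suc)

text \<open>In place of a conditional stands a loop whose body empties its own test register. The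
  flag \<open>b+3\<close> survives the first loop exactly if \<open>b+2\<close> was zero, and then
  the second loop opens the next diagonal.\<close>

lemma exec_next_pair_prog:
  assumes "s (b+3) = 0" "s (b+4) = 0"
    "s' = (if s (b+2) = 0 then s(b+1 := 0, b+2 := Suc (s (b+1)))
           else s(b+1 := Suc (s (b+1)), b+2 := s (b+2) - 1))"
  shows "exec (next_pair_prog b) s s'"
proof (cases "s (b+2) = 0")
  case True
  show ?thesis unfolding next_pair_prog_def
    by (rule exec_Seq, rule exec_Inc, rule exec_Seq, rule exec_While_0, use True in simp,
        rule exec_Seq, rule exec_move, simp, rule refl,
        rule exec_While_once, simp, rule exec_Seq, rule exec_Dec, rule exec_Seq, rule exec_Inc,
        rule exec_move)
      (use True assms in \<open>auto simp: fun_eq_iff\<close>)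
next
  case False
  show ?thesis unfolding next_pair_prog_def
    by (rule exec_Seq, rule exec_Inc, rule exec_Seq, rule exec_While_once, use False in simp,
        rule exec_Seq, rule exec_Dec, rule exec_Seq, rule exec_Inc, rule exec_Seq, rule exec_Dec,
        rule exec_move, simp, rule refl, simp,
        rule exec_Seq, rule exec_move, simp, rule refl, rule exec_While_0')
      (use False assms in \<open>auto simp: fun_eq_iff\<close>)
qed

text \<open>The sum of \<open>s b\<close> and the code of the current pair is invariant; the
  induction on it is why the starting pair is arbitrary.\<close>

lemma exec_decode_prog:
  assumes "s (b+3) = 0" "s (b+4) = 0"
    "s' = s(b := 0, b+1 := pfst (s b + pair (s (b+1)) (s (b+2))), b+2 := psnd (s b + pair (s (b+1)) (s (b+2))))"
  shows "exec (decode_prog b) s s'"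
  using assms unfolding decode_prog_def
proof (induction "s b" arbitrary: s s')
  case 0
  then have "s' = s" by auto
  then show ?case using 0 exec_While_0 by auto
next
  case (Suc n)
  let ?u = "s (b+1)" and ?v = "s (b+2)"
  define s1 where "s1 = (if ?v = 0 then s(b := n, b+1 := 0, b+2 := Suc ?u)
    else s(b := n, b+1 := Suc ?u, b+2 := ?v - 1))"
  have b: "s b = Suc n" using Suc(2) by simp
  have dec: "exec (Dec b) s (s(b := n))"
    by (rule exec_DecI) (simp add: b)
  have step: "exec (next_pair_prog b) (s(b := n)) s1"
    by (rule exec_next_pair_prog) (use Suc.prems in \<open>simp_all add: s1_def\<close>)
  have rest: "exec (While b (Dec b ;; next_pair_prog b)) s1 s'"
  proof (rule Suc.hyps(1))
    show "n = s1 b" "s1 (b+3) = 0" "s1 (b+4) = 0" using Suc.prems by (simp_all add: s1_def)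
    have "s1 b + pair (s1 (b+1)) (s1 (b+2)) = s b + pair ?u ?v"
      using triangle_pair(1)[of ?u] triangle_pair(2)[of ?u "?v - 1"] by (cases ?v) (simp_all add: s1_def b)
    moreover have "s(b := 0, b+1 := i, b+2 := j) = s1(b := 0, b+1 := i, b+2 := j)" for i j
      by (auto simp: s1_def fun_eq_iff)
    ultimately show "s' = s1(b := 0, b+1 := pfst (s1 b + pair (s1 (b+1)) (s1 (b+2))),
        b+2 := psnd (s1 b + pair (s1 (b+1)) (s1 (b+2))))"
      by (simp only: Suc.prems(3))
  qed
  show ?case
    by (rule exec_While_Suc[OF _ exec_Seq[OF dec step] rest]) (simp add: b)
qed

lemma exec_decode_prog_0:
  assumes "s (b+1) = 0" "s (b+2) = 0" "s (b+3) = 0" "s (b+4) = 0"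
    "s' = s(b := 0, b+1 := pfst (s b), b+2 := psnd (s b))"
  shows "exec (decode_prog b) s s'"
proof -
  have "pair 0 0 = 0" by (simp add: pair_def prod_encode_def)
  then show ?thesis using assms by (intro exec_decode_prog) auto
qed

lemma exec_funpow:
  assumes "implements c f" "\<And>r. r > Suc b \<Longrightarrow> s r = 0" "s' = s(b := 0, Suc b := (f ^^ s b) (s (Suc b)))"
  shows "exec (While b (Dec b ;; c (Suc b))) s s'"
  using assms(2,3)
proof (induction "s b" arbitrary: s s')
  case 0
  then have "s' = s" by auto
  then show ?case using 0 exec_While_0 by auto
next
  case (Suc n)
  then have b: "s b = Suc n" by simp
  show ?case
    by (rule exec_While_Suc, use b in simp, rule exec_Seq, rule exec_Dec, rule implementsD[OF assms(1) _ refl],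
        use Suc.prems in simp, rule Suc.hyps(1))
      (use Suc.prems b in \<open>auto simp: fun_eq_iff simp del: funpow.simps simp: funpow_Suc_right\<close>)
qed

lemma exec_copy:
  assumes "d \<noteq> r" "e \<noteq> r" "d \<noteq> e" "s e = 0" "s' = s(d := s d + s r)"
  shows "exec (move_reg2 r d e ;; move_reg e r) s s'"
  by (rule exec_Seq, rule exec_move2, rule assms, rule assms, rule assms, rule refl, rule exec_move)
    (use assms in \<open>auto simp: fun_eq_iff\<close>)

text \<open>The bound \<open>K\<close> is needed because the tape alphabet has one bit per register.\<close>

lemma pr_implemented:
  assumes "pr f"
  shows "\<exists>c K. implements c f \<and> (\<forall>b. registers (c b) \<subseteq> {..<b + K})"
  using assms
proof induction
  case pr_zero
  show ?case
    by (rule exI[of _ "\<lambda>b. While b (Dec b)"], rule exI[of _ 1]) (auto simp: implements_def intro: exec_clear)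
next
  case pr_Suc_basic
  show ?case
    by (rule exI[of _ Inc], rule exI[of _ 1]) (auto simp: implements_def intro: exec_Inc)
next
  case pr_pfst_basic
  show ?case
    by (rule exI[of _ "\<lambda>b. decode_prog b ;; move_reg (b+1) b ;; While (b+2) (Dec (b+2))"], rule exI[of _ 5],
        intro conjI, unfold implements_def, intro allI impI,
        rule exec_Seq, rule exec_decode_prog_0[OF _ _ _ _ refl], simp, simp, simp, simp,
        rule exec_Seq, rule exec_move[OF _ refl], simp, rule exec_clear)
     (auto simp: fun_eq_iff decode_prog_def next_pair_prog_def)
next
  case pr_psnd_basic
  show ?case
    by (rule exI[of _ "\<lambda>b. decode_prog b ;; move_reg (b+2) b ;; While (b+1) (Dec (b+1))"], rule exI[of _ 5],
        intro conjI, unfold implements_def, intro allI impI,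
        rule exec_Seq, rule exec_decode_prog_0[OF _ _ _ _ refl], simp, simp, simp, simp,
        rule exec_Seq, rule exec_move[OF _ refl], simp, rule exec_clear)
     (auto simp: fun_eq_iff decode_prog_def next_pair_prog_def)
next
  case (pr_pair f g)
  then obtain cf K cg L where f: "implements cf f" "\<And>b. registers (cf b) \<subseteq> {..<b + K}"
    and g: "implements cg g" "\<And>b. registers (cg b) \<subseteq> {..<b + L}" by metis
  \<comment> \<open>While \<open>f\<close> runs at base \<open>b+1\<close>, the input waits in
    \<open>b\<close>; while \<open>g\<close> runs at base \<open>b+2\<close>, the value of
    \<open>f\<close> waits in \<open>b+1\<close>. Then \<open>b\<close> is cleared to receive the
    code of the pair.\<close>
  let ?c = "\<lambda>b. (move_reg2 b (b+1) (b+2) ;; move_reg (b+2) b) ;; cf (b+1) ;;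
    (move_reg2 b (b+2) (b+3) ;; move_reg (b+3) b) ;; cg (b+2) ;; While b (Dec b) ;; encode_prog b"
  have 1: "implements ?c (\<lambda>x. pair (f x) (g x))"
    unfolding implements_def
    by (intro allI impI, rule exec_Seq, rule exec_copy[OF _ _ _ _ refl], simp, simp, simp, simp,
        rule exec_Seq, rule implementsD[OF f(1) _ refl], simp,
        rule exec_Seq, rule exec_copy[OF _ _ _ _ refl], simp, simp, simp, simp,
        rule exec_Seq, rule implementsD[OF g(1) _ refl], simp,
        rule exec_Seq, rule exec_clear[OF refl], rule exec_encode_prog)
      (auto simp: fun_eq_iff)
  have 2: "registers (?c b) \<subseteq> {..<b + (K + L + 5)}" for b
    using order_trans[OF f(2)[of "b+1"], of "{..<b + (K + L + 5)}"]
      order_trans[OF g(2)[of "b+2"], of "{..<b + (K + L + 5)}"]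
    by (simp add: encode_prog_def)
  show ?case by (rule exI[of _ ?c], rule exI[of _ "K + L + 5"], rule conjI, rule 1, rule allI, rule 2)
next
  case (pr_comp f g)
  then obtain cf K cg L where f: "implements cf f" "\<And>b. registers (cf b) \<subseteq> {..<b + K}"
    and g: "implements cg g" "\<And>b. registers (cg b) \<subseteq> {..<b + L}" by metis
  let ?c = "\<lambda>b. cg b ;; cf b"
  have 1: "implements ?c (\<lambda>x. f (g x))"
    unfolding implements_def
    by (intro allI impI, rule exec_Seq, rule implementsD[OF g(1) _ refl], simp, rule implementsD[OF f(1)]) auto
  have 2: "registers (?c b) \<subseteq> {..<b + (K + L)}" for b
    using order_trans[OF f(2)[of b], of "{..<b + (K + L)}"] order_trans[OF g(2)[of b], of "{..<b + (K + L)}"]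
    by simp
  show ?case by (rule exI[of _ ?c], rule exI[of _ "K + L"], rule conjI, rule 1, rule allI, rule 2)
next
  case (pr_funpow_basic f)
  then obtain cf K where f: "implements cf f" "\<And>b. registers (cf b) \<subseteq> {..<b + K}" by metis
  let ?c = "\<lambda>b. decode_prog b ;; move_reg (b+2) b ;; While b (Dec b ;; cf (Suc b)) ;; move_reg (b+1) b"
  have 1: "implements ?c (\<lambda>x. (f ^^ psnd x) (pfst x))"
    unfolding implements_def
    by (intro allI impI, rule exec_Seq, rule exec_decode_prog_0[OF _ _ _ _ refl], simp, simp, simp, simp,
        rule exec_Seq, rule exec_move[OF _ refl], simp,
        rule exec_Seq, rule exec_funpow[OF f(1) _ refl], simp, rule exec_move)
      (auto simp: fun_eq_iff)
  have 2: "registers (?c b) \<subseteq> {..<b + (K + 6)}" for b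
    using order_trans[OF f(2)[of "Suc b"], of "{..<b + (K + 6)}"]
    by (simp add: decode_prog_def next_pair_prog_def)
  show ?case by (rule exI[of _ ?c], rule exI[of _ "K + 6"], rule conjI, rule 1, rule allI, rule 2)
qed

text \<open>Stronger than decidability by a machine. One unbounded search over such predicates still
  yields exactly the recursively enumerable sets (Kleene's normal form).\<close>

definition decidable :: "(nat \<Rightarrow> bool) \<Rightarrow> bool" where
  "decidable P \<longleftrightarrow> pr (\<lambda>x. of_bool (P x))"

definition semidecidable :: "(nat \<Rightarrow> bool) \<Rightarrow> bool" where
  "semidecidable P \<longleftrightarrow> (\<exists>Q. decidable Q \<and> (\<forall>x. P x \<longleftrightarrow> (\<exists>t. Q (pair x t))))"

section \<open>Closure properties of primitive recursive functions\<close>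

lemma pr_Suc: "pr f \<Longrightarrow> pr (\<lambda>x. Suc (f x))"
  using pr_comp[OF pr_Suc_basic] .

lemma pr_pfst: "pr f \<Longrightarrow> pr (\<lambda>x. pfst (f x))"
  using pr_comp[OF pr_pfst_basic] .

lemma pr_psnd: "pr f \<Longrightarrow> pr (\<lambda>x. psnd (f x))"
  using pr_comp[OF pr_psnd_basic] .

lemma pr_funpow:
  assumes "pr f" "pr g" "pr h"
  shows "pr (\<lambda>x. (f ^^ h x) (g x))"
  using pr_comp[OF pr_funpow_basic[OF assms(1)] pr_pair[OF assms(2,3)]] by simp

lemma pr_id: "pr (\<lambda>x. x)"
  using pr_pair[OF pr_pfst_basic pr_psnd_basic] by simp

lemma pr_const: "pr (\<lambda>_. n)"
  by (induction n) (simp_all add: pr_zero pr_Suc)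

lemmas pr_basic = pr_id pr_const pr_Suc pr_pair pr_pfst pr_psnd

lemma pr_cong:
  assumes "pr g" "\<And>x. f x = g x"
  shows "pr f"
proof -
  have "f = g" using assms(2) by (rule ext)
  then show ?thesis using assms(1) by simp
qed

text \<open>The iterated map acts on triples of argument, counter and value.\<close>

lemma pr_rec:
  assumes "pr (\<lambda>x. g (pfst x) (pfst (psnd x)) (psnd (psnd x)))" "pr f" "pr h"
  shows "pr (\<lambda>x. rec_nat (f x) (g x) (h x))"
proof -
  let ?g = "\<lambda>y. g (pfst y) (pfst (psnd y)) (psnd (psnd y))"
  let ?F = "\<lambda>y. pair (pfst y) (pair (Suc (pfst (psnd y))) (?g y))"
  have F: "(?F ^^ n) (pair x (pair 0 (f x))) = pair x (pair n (rec_nat (f x) (g x) n))" for x n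
    by (induction n) auto
  have "pr (\<lambda>x. psnd (psnd ((?F ^^ h x) (pair x (pair 0 (f x))))))"
    by (intro pr_basic pr_funpow assms)
  then show ?thesis by (rule pr_cong) (simp add: F)
qed

lemma pr_if_zero:
  assumes "pr f" "pr g" "pr h"
  shows "pr (\<lambda>x. if f x = 0 then g x else h x)"
proof (rule pr_cong)
  show "pr (\<lambda>x. rec_nat (g x) (\<lambda>_ _. h x) (f x))"
    by (intro pr_rec assms pr_comp[OF assms(3) pr_pfst_basic])
  show "(if f x = 0 then g x else h x) = rec_nat (g x) (\<lambda>_ _. h x) (f x)" for x
    by (cases "f x") auto
qed

lemma pr_pred:
  assumes "pr f"
  shows "pr (\<lambda>x. f x - 1)"
proof (rule pr_cong)
  show "pr (\<lambda>x. rec_nat 0 (\<lambda>n _. n) (f x))" by (intro pr_rec assms pr_basic)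
  show "f x - 1 = rec_nat 0 (\<lambda>n _. n) (f x)" for x
    by (cases "f x") auto
qed

section \<open>Searching by Turing machine\<close>

lemma tm_step_funpow_halted: "tm_halted M c \<Longrightarrow> (tm_step M ^^ n) c = c"
proof (induction n)
  case (Suc n)
  then show ?case by (cases c) auto
qed simp

text \<open>Symbol 1 is \<open>set_encode {0}\<close>, so the marks of the input are already bits of
  register 0. Only cell 0 is described apart, as its bit \<open>k\<close> is still missing.\<close>

lemma tm_initial_register_tape:
  assumes "k > 0"
  shows "tm_initial x =
    (0, \<lambda>i. if i = 0 then of_bool (x > 0) else register_tape k ((\<lambda>_. 0)(0 := x)) i, 0)"
proof -
  have *: "{r. r < k \<and> i < int (((\<lambda>_. 0)(0 := x)) r)} = (if i < int x then {0} else {})" if "i \<ge> 0" for i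
    using that assms by auto
  have "register_tape k ((\<lambda>_. 0)(0 := x)) i = of_bool (0 \<le> i \<and> i < int x)" if "i \<noteq> 0" for i
    using that unfolding register_tape_def by (cases "i < 0") (simp_all add: * del: fun_upd_apply)
  then show ?thesis
    by (auto simp: tm_initial_def fun_eq_iff simp del: fun_upd_apply)
qed

lemma odd_register_tape: "k > 0 \<Longrightarrow> odd (register_tape k s 0) \<longleftrightarrow> s 0 > 0"
  using mem_register_tape(1)[of 0 0 k s] by simp

text \<open>Register 0 holds \<open>Suc (pair x t)\<close> while the search is at \<open>t\<close>.
  The loop body \<open>H\<close> passes to \<open>Suc t\<close>, or to 0 once \<open>Q\<close>
  holds, which ends the loop and the run; the \<open>Suc\<close> keeps a pending search apart from a
  finished one.\<close>

lemma recursively_enumerable_search: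
  assumes "decidable Q"
  shows "recursively_enumerable {x. \<exists>t. Q (pair x t)}"
proof -
  let ?F = "\<lambda>x. Suc (pair x 0)"
  define H where
    "H = (\<lambda>y. if of_bool (Q (y - 1)) = (0::nat) then Suc (pair (pfst (y - 1)) (Suc (psnd (y - 1)))) else 0)"
  have H_Suc: "H (Suc y) = (if Q y then 0 else Suc (pair (pfst y) (Suc (psnd y))))" for y
    by (simp add: H_def)
  have "pr (\<lambda>y. of_bool (Q (y - 1)))"
    using pr_comp[OF assms[unfolded decidable_def] pr_pred[OF pr_id]] .
  then have "pr ?F" "pr H"
    unfolding H_def by (intro pr_basic pr_if_zero pr_pred; assumption)+
  then obtain cF cG K L where F: "implements cF ?F" "\<And>b. registers (cF b) \<subseteq> {..<b + K}"
    and G: "implements cG H" "\<And>b. registers (cG b) \<subseteq> {..<b + L}"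
    using pr_implemented[of ?F] pr_implemented[of H] by blast
  define k where "k = K + L + 1"
  have k: "k > 0" by (simp add: k_def)
  \<comment> \<open>An additional first rule sets the missing bit \<open>k\<close> and so turns the
    initial tape into a register tape.\<close>
  define mark :: tm_rule where "mark = (\<lambda>a. (1, set_encode (insert k (set_decode a)), Stay))"
  define P0 where "P0 = mark # code k (cF 0) 1"
  define q where "q = length P0"
  define P where "P = P0 @ code k (While 0 (cG 0)) q"
  have q: "length P0 = q" "q = Suc (code_length (cF 0))" by (simp_all add: q_def P0_def)
  have Pq: "P ! q = (\<lambda>a. if 0 \<in> set_decode a then (q + 1, a, Stay) else (q + code_length (cG 0) + 2, a, Stay))"
    and Pj: "P ! (q + 1 + code_length (cG 0)) = (\<lambda>a. (q, a, Stay))"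
    by (simp_all add: P_def nth_append q(1))
  let ?M = "machine k P"
  let ?c = "\<lambda>y. (q, register_tape k ((\<lambda>_. 0)(0 := y)), 0::int)"
  have reg: "registers (cF 0) \<subseteq> {..<k}" "registers (cG 0) \<subseteq> {..<k}"
    using F(2)[of 0] G(2)[of 0] by (auto simp: k_def)
  have lenP: "length P = q + code_length (cG 0) + 2"
    by (simp add: P_def q(1))
  have start: "reaches ?M (tm_initial x) (?c (Suc (pair x 0)))" for x
  proof -
    let ?s = "(\<lambda>_. 0)(0 := x)"
    let ?t = "\<lambda>i. if i = 0 then of_bool (x > 0) else register_tape k ?s i"
    have "set_decode (of_bool (0 < x)) = (if 0 < x then {0} else {})"
      using set_encode_inverse[of "{0}"] by (simp del: set_encode_inverse)
    then have *: "set_encode (insert k (set_decode (of_bool (x > 0)))) = register_tape k ?s 0"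
      unfolding register_tape_def using k
      by (simp del: set_encode_insert) (auto simp del: set_encode_insert intro!: arg_cong[where f=set_encode])
    have "tm_step ?M (0, ?t, 0) = (1, ?t(0 := register_tape k ?s 0), move_head Stay 0)"
      by (rule tm_step_machine) (use lenP * in \<open>simp_all add: P_def P0_def mark_def register_tape_bound\<close>)
    moreover have "?t(0 := register_tape k ?s 0) = register_tape k ?s" by auto
    ultimately have "tm_step ?M (tm_initial x) = (1, register_tape k ?s, 0)"
      by (simp only: tm_initial_register_tape[OF k] move_head.simps)
    then have "reaches ?M (tm_initial x) (1, register_tape k ?s, 0)"
      by (rule reaches_step)
    also have "reaches ?M (1, register_tape k ?s, 0) (?c (Suc (pair x 0)))"
      using reaches_exec[of "cF 0" ?s "(\<lambda>_. 0)(0 := Suc (pair x 0))" k P "[mark]" "code k (While 0 (cG 0)) q"]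
        reg implementsD[OF F(1), of 0 ?s]
      by (simp add: P_def P0_def q(2))
    finally show ?thesis .
  qed
  \<comment> \<open>A round takes at least one step, hence \<open>Suc n\<close>; this bounds running
    times from below when the search fails.\<close>
  have step: "\<exists>n. (tm_step ?M ^^ Suc n) (?c (Suc y)) = ?c (H (Suc y))" for y
  proof -
    let ?s = "(\<lambda>_. 0)(0 := Suc y)" and ?s' = "(\<lambda>_. 0)(0 := H (Suc y))"
    let ?P1 = "P0 @ [code k (While 0 (cG 0)) q ! 0]"
    have test: "tm_step ?M (?c (Suc y)) = (q + 1, register_tape k ?s, 0)"
    proof -
      have "tm_step ?M (?c (Suc y)) = (q + 1, (register_tape k ?s)(0 := register_tape k ?s 0), move_head Stay 0)"
        by (rule tm_step_machine) (simp_all add: Pq odd_register_tape k register_tape_bound lenP)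
      then show ?thesis by (simp only: fun_upd_triv move_head.simps)
    qed
    have P: "P = ?P1 @ code k (cG 0) (length ?P1) @ [\<lambda>a. (q, a, Stay)]" and q': "length ?P1 = q + 1"
      by (simp_all add: P_def q(1))
    have "reaches ?M (q + 1, register_tape k ?s, 0) (q + 1 + code_length (cG 0), register_tape k ?s', 0)"
      using reaches_exec[OF implementsD[OF G(1), of 0 ?s ?s'] reg(2) P] unfolding q' by simp
    also have "reaches ?M \<dots> (?c (H (Suc y)))"
      by (rule reaches_keep[where m=Stay]) (simp_all add: Pj[simplified] lenP)
    finally obtain n where "(tm_step ?M ^^ n) (q + 1, register_tape k ?s, 0) = ?c (H (Suc y))"
      unfolding reaches_def by blast
    then show ?thesis
      by (intro exI[of _ n]) (simp only: funpow_Suc_right comp_apply test)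
  qed
  have "(\<exists>t. Q (pair x t)) \<longleftrightarrow> (\<exists>c. tm_halts_in ?M x c)" for x
  proof
    assume "\<exists>t. Q (pair x t)"
    then obtain t where t: "Q (pair x t)" "\<And>t'. t' < t \<Longrightarrow> \<not> Q (pair x t')"
      using exists_least_iff[of "\<lambda>t. Q (pair x t)"] by blast
    have "reaches ?M (tm_initial x) (?c (Suc (pair x t')))" if "t' \<le> t" for t'
      using that
    proof (induction t')
      case 0 show ?case by (rule start)
    next
      case (Suc t')
      then have "reaches ?M (?c (Suc (pair x t'))) (?c (Suc (pair x (Suc t'))))"
        using step[of "pair x t'"] H_Suc[of "pair x t'"] t(2)[of t'] unfolding reaches_def
        by (auto simp del: funpow.simps)
      then show ?case using Suc reaches_trans by (meson Suc_leD)
    qed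
    also have "reaches ?M (?c (Suc (pair x t))) (?c 0)"
      using step[of "pair x t"] H_Suc[of "pair x t"] t(1) unfolding reaches_def by (auto simp del: funpow.simps)
    also have "reaches ?M (?c 0) (length P, register_tape k ((\<lambda>_. 0)(0 := 0)), 0)"
    proof (rule reaches_keep[where m=Stay])
      show "(P ! q) (register_tape k ((\<lambda>_. 0)(0 := 0)) 0) =
          (length P, register_tape k ((\<lambda>_. 0)(0 := 0)) 0, Stay)"
        unfolding Pq lenP by (simp add: odd_register_tape k)
    qed (simp_all add: lenP)
    finally obtain n where
      "(tm_step ?M ^^ n) (tm_initial x) = (length P, register_tape k ((\<lambda>_. 0)(0 := 0)), 0)"
      unfolding reaches_def by blast
    moreover have "tm_halted ?M (length P, register_tape k ((\<lambda>_. 0)(0 := 0)), 0)"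
      by (simp only: tm_halted_machine)
    ultimately show "\<exists>c. tm_halts_in ?M x c"
      unfolding tm_halts_in_def by blast
  next
    assume "\<exists>c. tm_halts_in ?M x c"
    then obtain m c where m: "(tm_step ?M ^^ m) (tm_initial x) = c" and c: "tm_halted ?M c"
      unfolding tm_halts_in_def by blast
    show "\<exists>t. Q (pair x t)"
    proof (rule ccontr)
      assume *: "\<nexists>t. Q (pair x t)"
      \<comment> \<open>A failing search is back at the loop test after arbitrarily many steps,
        whereas a halted configuration never changes.\<close>
      have "\<exists>n\<ge>t. (tm_step ?M ^^ n) (tm_initial x) = ?c (Suc (pair x t))" for t
      proof (induction t)
        case 0 show ?case using start[of x] unfolding reaches_def by blast
      next
        case (Suc t)
        then obtain n where n: "n \<ge> t" "(tm_step ?M ^^ n) (tm_initial x) = ?c (Suc (pair x t))" by blast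
        obtain n' where "(tm_step ?M ^^ Suc n') (?c (Suc (pair x t))) = ?c (Suc (pair x (Suc t)))"
          using step[of "pair x t"] H_Suc[of "pair x t"] * by (auto simp del: funpow.simps)
        then have "(tm_step ?M ^^ (Suc n' + n)) (tm_initial x) = ?c (Suc (pair x (Suc t)))"
          by (simp only: funpow_add comp_apply n)
        moreover have "Suc n' + n \<ge> Suc t" using n(1) by simp
        ultimately show ?case by blast
      qed
      then obtain n where "n \<ge> m" "(tm_step ?M ^^ n) (tm_initial x) = ?c (Suc (pair x m))" by blast
      moreover have "(tm_step ?M ^^ n) (tm_initial x) = c" if "n \<ge> m"
        using that m tm_step_funpow_halted[OF c, of "n - m"] funpow_add[of "n - m" m "tm_step ?M"] by simp
      ultimately show False using c lenP by (simp add: tm_halted_machine del: tm_halted.simps)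
    qed
  qed
  then show ?thesis
    unfolding recursively_enumerable_def using wf_tm_machine by blast
qed

theorem recursively_enumerable_if_semidecidable: "semidecidable P \<Longrightarrow> recursively_enumerable (Collect P)"
proof -
  assume "semidecidable P"
  then obtain Q where Q: "decidable Q" "\<And>x. P x \<longleftrightarrow> (\<exists>t. Q (pair x t))"
    unfolding semidecidable_def by blast
  have "Collect P = {x. \<exists>t. Q (pair x t)}" using Q(2) by auto
  then show "recursively_enumerable (Collect P)" using recursively_enumerable_search[OF Q(1)] by simp
qed

section \<open>Decidable and semidecidable predicates\<close>

lemma pr_add: "pr f \<Longrightarrow> pr g \<Longrightarrow> pr (\<lambda>x. f x + g x)"
proof -
  assume "pr f" "pr g"
  then have "pr (\<lambda>x. rec_nat (f x) (\<lambda>_ a. Suc a) (g x))" by (intro pr_rec pr_basic)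
  moreover have "rec_nat m (\<lambda>_ a. Suc a) n = m + n" for m n :: nat by (induction n) auto
  ultimately show ?thesis by simp
qed

lemma pr_mult: "pr f \<Longrightarrow> pr g \<Longrightarrow> pr (\<lambda>x. f x * g x)"
proof -
  assume f: "pr f" and g: "pr g"
  then have "pr (\<lambda>x. rec_nat 0 (\<lambda>_ a. a + f x) (g x))"
    by (intro pr_rec pr_basic pr_add pr_comp[OF f pr_pfst_basic])
  moreover have "rec_nat 0 (\<lambda>_ a. a + m) n = m * n" for m n :: nat by (induction n) auto
  ultimately show ?thesis by simp
qed

lemma pr_power: "pr f \<Longrightarrow> pr g \<Longrightarrow> pr (\<lambda>x. f x ^ g x)"
proof -
  assume f: "pr f" and g: "pr g"
  then have "pr (\<lambda>x. rec_nat 1 (\<lambda>_ a. a * f x) (g x))"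
    by (intro pr_rec pr_basic pr_mult pr_comp[OF f pr_pfst_basic])
  moreover have "rec_nat 1 (\<lambda>_ a. a * m) n = m ^ n" for m n :: nat by (induction n) auto
  ultimately show ?thesis by simp
qed

lemma pr_diff: "pr f \<Longrightarrow> pr g \<Longrightarrow> pr (\<lambda>x. f x - g x)"
proof -
  assume "pr f" "pr g"
  then have "pr (\<lambda>x. rec_nat (f x) (\<lambda>_ a. a - 1) (g x))" by (intro pr_rec pr_basic pr_pred)
  moreover have "rec_nat m (\<lambda>_ a. a - 1) n = m - n" for m n :: nat by (induction n) auto
  ultimately show ?thesis by simp
qed

lemma pr_if:
  assumes "decidable P" "pr f" "pr g"
  shows "pr (\<lambda>x. if P x then f x else g x)"
proof (rule pr_cong)
  show "pr (\<lambda>x. if of_bool (P x) = (0::nat) then g x else f x)"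
    using assms unfolding decidable_def by (intro pr_if_zero)
qed auto

lemma decidable_const: "decidable (\<lambda>_. b)"
  unfolding decidable_def by (rule pr_const)

lemma decidableI:
  assumes "pr f" "\<And>x. P x \<longleftrightarrow> f x = 0"
  shows "decidable P"
  unfolding decidable_def
proof (rule pr_cong)
  show "pr (\<lambda>x. if f x = 0 then 1 else 0)" by (intro pr_if_zero assms pr_basic)
qed (use assms in auto)

lemma decidable_le: "pr f \<Longrightarrow> pr g \<Longrightarrow> decidable (\<lambda>x. f x \<le> g x)"
  by (rule decidableI[of "\<lambda>x. f x - g x"]) (auto intro: pr_diff)

lemma decidable_less: "pr f \<Longrightarrow> pr g \<Longrightarrow> decidable (\<lambda>x. f x < g x)"
  using decidable_le[of "\<lambda>x. Suc (f x)" g] by (simp add: pr_Suc Suc_le_eq)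

lemma decidable_eq: "pr f \<Longrightarrow> pr g \<Longrightarrow> decidable (\<lambda>x. f x = g x)"
  by (rule decidableI[of "\<lambda>x. (f x - g x) + (g x - f x)"]) (auto intro: pr_diff pr_add)

lemma decidable_not: "decidable P \<Longrightarrow> decidable (\<lambda>x. \<not> P x)"
  by (rule decidableI[of "\<lambda>x. of_bool (P x)"]) (auto simp: decidable_def)

lemma decidable_conj: "decidable P \<Longrightarrow> decidable Q \<Longrightarrow> decidable (\<lambda>x. P x \<and> Q x)"
  unfolding decidable_def by (drule (1) pr_mult) (simp flip: of_bool_conj)

lemma decidable_disj: "decidable P \<Longrightarrow> decidable Q \<Longrightarrow> decidable (\<lambda>x. P x \<or> Q x)"
  using decidable_not[OF decidable_conj[OF decidable_not decidable_not]] by simp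

lemma decidable_imp: "decidable P \<Longrightarrow> decidable Q \<Longrightarrow> decidable (\<lambda>x. P x \<longrightarrow> Q x)"
  unfolding imp_conv_disj by (intro decidable_disj decidable_not)

lemma decidable_comp: "decidable P \<Longrightarrow> pr f \<Longrightarrow> decidable (\<lambda>x. P (f x))"
  unfolding decidable_def by (rule pr_comp)

lemma decidable_all_less:
  assumes "decidable (\<lambda>p. P (pfst p) (psnd p))" "pr f"
  shows "decidable (\<lambda>x. \<forall>i<f x. P x i)"
  unfolding decidable_def
proof (rule pr_cong)
  have P: "pr (\<lambda>p. of_bool (P (pfst p) (psnd p)))" using assms(1) unfolding decidable_def .
  have "pr (\<lambda>x. of_bool (P (pfst x) (pfst (psnd x))))"
    using pr_comp[OF P pr_pair[OF pr_pfst_basic pr_pfst[OF pr_psnd_basic]]] by simp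
  then show "pr (\<lambda>x. rec_nat 1 (\<lambda>i a. a * of_bool (P x i)) (f x))"
    by (intro pr_rec pr_basic pr_mult assms)
  have R: "rec_nat 1 (\<lambda>i a. a * of_bool (P x i)) n = (of_bool (\<forall>i<n. P x i) :: nat)" for x n
    by (induction n) (auto simp: less_Suc_eq)
  show "(of_bool (\<forall>i<f x. P x i) :: nat) = rec_nat 1 (\<lambda>i a. a * of_bool (P x i)) (f x)" for x
    by (rule R[symmetric])
qed

lemma decidable_ex_less:
  assumes "decidable (\<lambda>p. P (pfst p) (psnd p))" "pr f"
  shows "decidable (\<lambda>x. \<exists>i<f x. P x i)"
  using decidable_not[OF decidable_all_less[OF decidable_not[OF assms(1)] assms(2)]] by simp

lemma semidecidableI: "decidable Q \<Longrightarrow> (\<And>x. P x \<longleftrightarrow> (\<exists>t. Q (pair x t))) \<Longrightarrow> semidecidable P"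
  unfolding semidecidable_def by blast

lemma semidecidable_if_decidable:
  assumes "decidable P"
  shows "semidecidable P"
  by (rule semidecidableI[OF decidable_comp[OF assms pr_pfst_basic]]) simp

lemma semidecidable_ex_decidable:
  assumes "decidable (\<lambda>p. P (pfst p) (psnd p))"
  shows "semidecidable (\<lambda>x. \<exists>y. P x y)"
  using assms by (rule semidecidableI) simp

lemma semidecidable_comp:
  assumes "semidecidable P" "pr f"
  shows "semidecidable (\<lambda>x. P (f x))"
proof -
  obtain Q where Q: "decidable Q" "\<And>x. P x \<longleftrightarrow> (\<exists>t. Q (pair x t))"
    using assms(1) unfolding semidecidable_def by blast
  have "decidable (\<lambda>p. Q (pair (f (pfst p)) (psnd p)))"
    by (intro decidable_comp[OF Q(1)] pr_pair pr_psnd_basic pr_comp[OF assms(2) pr_pfst_basic])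
  then show ?thesis by (rule semidecidableI) (simp add: Q)
qed

lemma semidecidable_ex:
  assumes "semidecidable (\<lambda>p. P (pfst p) (psnd p))"
  shows "semidecidable (\<lambda>x. \<exists>y. P x y)"
proof -
  obtain Q where Q: "decidable Q" "\<And>p. P (pfst p) (psnd p) \<longleftrightarrow> (\<exists>t. Q (pair p t))"
    using assms unfolding semidecidable_def by blast
  have "decidable (\<lambda>p. Q (pair (pair (pfst p) (pfst (psnd p))) (psnd (psnd p))))"
    by (intro decidable_comp[OF Q(1)] pr_basic)
  moreover have "P x y \<longleftrightarrow> (\<exists>t. Q (pair (pair x y) t))" for x y
    using Q(2)[of "pair x y"] by simp
  then have "(\<exists>y. P x y) \<longleftrightarrow> (\<exists>t. Q (pair (pair x (pfst t)) (psnd t)))" for x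
    by (metis pfst_pair psnd_pair)
  ultimately show ?thesis by (intro semidecidableI) auto
qed

lemma semidecidable_conj:
  assumes "semidecidable P" "semidecidable Q"
  shows "semidecidable (\<lambda>x. P x \<and> Q x)"
proof -
  obtain P' where P: "decidable P'" "\<And>x. P x \<longleftrightarrow> (\<exists>t. P' (pair x t))"
    using assms(1) unfolding semidecidable_def by blast
  obtain Q' where Q: "decidable Q'" "\<And>x. Q x \<longleftrightarrow> (\<exists>t. Q' (pair x t))"
    using assms(2) unfolding semidecidable_def by blast
  have "decidable (\<lambda>p. P' (pair (pfst p) (pfst (psnd p))) \<and> Q' (pair (pfst p) (psnd (psnd p))))"
    by (intro decidable_conj decidable_comp[OF Q(1)] decidable_comp[OF P(1)] pr_basic)
  moreover have "P x \<and> Q x \<longleftrightarrow> (\<exists>t. P' (pair x (pfst t)) \<and> Q' (pair x (psnd t)))" for x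
    unfolding P(2) Q(2) by (metis pfst_pair psnd_pair)
  ultimately show ?thesis by (intro semidecidableI) auto
qed

lemma semidecidable_disj:
  assumes "semidecidable P" "semidecidable Q"
  shows "semidecidable (\<lambda>x. P x \<or> Q x)"
proof -
  obtain P' where P: "decidable P'" "\<And>x. P x \<longleftrightarrow> (\<exists>t. P' (pair x t))"
    using assms(1) unfolding semidecidable_def by blast
  obtain Q' where Q: "decidable Q'" "\<And>x. Q x \<longleftrightarrow> (\<exists>t. Q' (pair x t))"
    using assms(2) unfolding semidecidable_def by blast
  show ?thesis
    by (rule semidecidableI[OF decidable_disj[OF P(1) Q(1)]]) (auto simp: P(2) Q(2))
qed

lemma semidecidable_finite_ex:
  assumes "finite S" "\<And>s. s \<in> S \<Longrightarrow> semidecidable (P s)"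
  shows "semidecidable (\<lambda>x. \<exists>s\<in>S. P s x)"
  using assms
  by (induction S) (auto intro: semidecidable_disj semidecidable_if_decidable[OF decidable_const])

text \<open>Bounded collection: finitely many witnesses have a common bound \<open>T\<close>, so
  that the unbounded quantifier can be moved to the front.\<close>

lemma semidecidable_all_less:
  assumes "semidecidable (\<lambda>p. P (pfst p) (psnd p))" "pr f"
  shows "semidecidable (\<lambda>x. \<forall>i<f x. P x i)"
proof -
  obtain Q where Q: "decidable Q" "\<And>p. P (pfst p) (psnd p) \<longleftrightarrow> (\<exists>t. Q (pair p t))"
    using assms unfolding semidecidable_def by blast
  have P: "P x i \<longleftrightarrow> (\<exists>t. Q (pair (pair x i) t))" for x i
    using Q(2)[of "pair x i"] by simp
  have dec: "decidable (\<lambda>p. \<forall>i<f (pfst p). \<exists>t<psnd p. Q (pair (pair (pfst p) i) t))"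
    by (intro decidable_all_less decidable_ex_less decidable_comp[OF Q(1)] pr_basic pr_comp[OF assms(2) pr_pfst_basic])
  have eq: "(\<forall>i<n. P x i) \<longleftrightarrow> (\<exists>T. \<forall>i<n. \<exists>t<T. Q (pair (pair x i) t))" for x n
  proof
    assume "\<forall>i<n. P x i"
    then obtain t where t: "\<And>i. i < n \<Longrightarrow> Q (pair (pair x i) (t i))" unfolding P by metis
    have "t i < Suc (\<Sum>i<n. t i)" if "i < n" for i
      using that member_le_sum[of i "{..<n}" t] by (simp add: le_imp_less_Suc)
    with t show "\<exists>T. \<forall>i<n. \<exists>t<T. Q (pair (pair x i) t)" by blast
  qed (auto simp: P)
  show ?thesis by (rule semidecidableI[OF dec]) (simp add: eq)
qed

lemmas pr_intros = pr_basic pr_add pr_mult pr_power pr_diff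

lemmas decidable_intros = decidable_const decidable_eq decidable_le decidable_less decidable_not
  decidable_conj decidable_disj decidable_imp decidable_all_less decidable_ex_less

lemmas semidecidable_intros = semidecidable_conj semidecidable_disj semidecidable_ex semidecidable_all_less

text \<open>Any finite table is primitive recursive, whatever \<open>f\<close> is; applied to the
  transition table of a machine.\<close>

lemma pr_restrict_finite:
  assumes "finite A"
  shows "pr (\<lambda>x. if x \<in> A then f x else 0)"
  using assms
proof induction
  case (insert a A)
  have "pr (\<lambda>x. if x = a then f a else if x \<in> A then f x else 0)"
    by (intro pr_if insert decidable_intros pr_basic)
  then show ?case by (rule pr_cong) auto
qed (simp add: pr_zero)

section \<open>Simulation of Turing machines\<close>

text \<open>Stacks have the format of \<open>list_encode\<close>, with 0 for the empty list. As 0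
  has head 0 and tail 0, the empty stack reads as infinitely many blank cells.\<close>

definition hd0 :: "nat \<Rightarrow> nat" where "hd0 c = pfst (c - 1)"
definition tl0 :: "nat \<Rightarrow> nat" where "tl0 c = psnd (c - 1)"
definition cons0 :: "nat \<Rightarrow> nat \<Rightarrow> nat" where "cons0 a c = Suc (pair a c)"
definition nth0 :: "nat \<Rightarrow> nat \<Rightarrow> nat" where "nth0 c i = hd0 ((tl0 ^^ i) c)"

lemma pair_0_0 [simp]: "pair 0 0 = 0"
  by (simp add: pair_def prod_encode_def)

lemma hd0_cons0 [simp]: "hd0 (cons0 a c) = a"
  and tl0_cons0 [simp]: "tl0 (cons0 a c) = c"
  by (simp_all add: hd0_def tl0_def cons0_def)

lemma hd0_0 [simp]: "hd0 0 = 0" and tl0_0 [simp]: "tl0 0 = 0"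
  using pfst_pair[of 0 0] psnd_pair[of 0 0] by (simp_all add: hd0_def tl0_def)

lemma nth0_simps [simp]: "nth0 c 0 = hd0 c" "nth0 c (Suc i) = nth0 (tl0 c) i" "nth0 0 i = 0"
proof -
  show "nth0 0 i = 0" by (induction i) (simp_all add: nth0_def del: funpow.simps add: funpow_Suc_right)
qed (simp_all add: nth0_def funpow_Suc_right del: funpow.simps)

lemma pr_hd0: "pr f \<Longrightarrow> pr (\<lambda>x. hd0 (f x))"
  and pr_tl0: "pr f \<Longrightarrow> pr (\<lambda>x. tl0 (f x))"
  unfolding hd0_def tl0_def by (intro pr_basic pr_pred; assumption)+

lemma pr_cons0: "pr f \<Longrightarrow> pr g \<Longrightarrow> pr (\<lambda>x. cons0 (f x) (g x))"
  unfolding cons0_def by (intro pr_basic)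

lemma pr_nth0: "pr f \<Longrightarrow> pr g \<Longrightarrow> pr (\<lambda>x. nth0 (f x) (g x))"
  unfolding nth0_def by (intro pr_hd0 pr_funpow pr_tl0 pr_basic)

lemmas pr_list_intros = pr_intros pr_hd0 pr_tl0 pr_cons0 pr_nth0

fun move_code :: "head_move \<Rightarrow> nat" where
  "move_code Move_Left = 0" | "move_code Stay = 1" | "move_code Move_Right = 2"

text \<open>The value 0 says that no rule applies. The cut-off to states and symbols of the machine
  makes this primitive recursive although \<open>transition M\<close> may be any function.\<close>

definition rule_code :: "turing_machine \<Rightarrow> nat \<Rightarrow> nat" where
  "rule_code M x = (if x \<in> {x. pfst x < num_states M \<and> psnd x < num_symbols M}
     then case transition M (pfst x) (psnd x) of None \<Rightarrow> 0
       | Some (q, b, m) \<Rightarrow> Suc (pair q (pair b (move_code m)))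
     else 0)"

lemma pr_rule_code: "pr (rule_code M)"
proof -
  have "{x. pfst x < num_states M \<and> psnd x < num_symbols M}
      \<subseteq> (\<lambda>(a, b). pair a b) ` ({..<num_states M} \<times> {..<num_symbols M})"
  proof
    fix x assume "x \<in> {x. pfst x < num_states M \<and> psnd x < num_symbols M}"
    then show "x \<in> (\<lambda>(a, b). pair a b) ` ({..<num_states M} \<times> {..<num_symbols M})"
      by (intro image_eqI[of _ _ "(pfst x, psnd x)"]) auto
  qed
  then have "finite {x. pfst x < num_states M \<and> psnd x < num_symbols M}"
    by (rule finite_subset) auto
  from pr_restrict_finite[OF this] show ?thesis
    unfolding rule_code_def .
qed

text \<open>A configuration is coded by its state, the (coded) stack of cells left of the head, nearest first, and
  the stack of the remaining cells.\<close>

definition step_code :: "turing_machine \<Rightarrow> nat \<Rightarrow> nat" where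
  "step_code M y = (let l = pfst (psnd y); r = psnd (psnd y); t = rule_code M (pair (pfst y) (hd0 r));
       q = pfst (t - 1); b = pfst (psnd (t - 1)); m = psnd (psnd (t - 1))
     in if t = 0 then y
        else if m = 0 then pair q (pair (tl0 l) (cons0 (hd0 l) (cons0 b (tl0 r))))
        else if m = 1 then pair q (pair l (cons0 b (tl0 r)))
        else pair q (pair (cons0 b l) (tl0 r)))"

lemma pr_step_code: "pr (step_code M)"
proof -
  have "pr (\<lambda>y. step_code M y)"
    unfolding step_code_def Let_def
    by (intro pr_if decidable_intros pr_list_intros pr_pred pr_comp[OF pr_rule_code])
  then show ?thesis by simp
qed

text \<open>Stack and tape are compared cell by cell, since stacks that differ in trailing blanks
  describe the same tape.\<close>

fun represents :: "nat \<Rightarrow> tm_config \<Rightarrow> bool" where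
  "represents y (q, t, h) \<longleftrightarrow> pfst y = q \<and> (\<forall>i. nth0 (psnd (psnd y)) i = t (h + int i)) \<and>
     (\<forall>i. nth0 (pfst (psnd y)) i = t (h - 1 - int i))"

text \<open>Keeps the run inside the table to which \<open>rule_code\<close> is cut off.\<close>

fun valid_config :: "turing_machine \<Rightarrow> tm_config \<Rightarrow> bool" where
  "valid_config M (q, t, h) \<longleftrightarrow> q < num_states M \<and> (\<forall>j. t j < num_symbols M)"

lemma rule_code_represents:
  assumes "valid_config M (q, t, h)" "represents y (q, t, h)"
  shows "rule_code M (pair (pfst y) (hd0 (psnd (psnd y)))) = (case transition M q (t h) of None \<Rightarrow> 0
       | Some (q, b, m) \<Rightarrow> Suc (pair q (pair b (move_code m))))"
proof -
  have "hd0 (psnd (psnd y)) = t h"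
    using assms(2) by (auto dest!: spec[of _ 0])
  then show ?thesis using assms by (simp add: rule_code_def)
qed

lemma represents_step:
  assumes "wf_tm M" "valid_config M c" "represents y c"
  shows "valid_config M (tm_step M c) \<and> represents (step_code M y) (tm_step M c)"
proof -
  obtain q t h where c: "c = (q, t, h)" by (cases c)
  let ?l = "pfst (psnd y)" and ?r = "psnd (psnd y)"
  have r: "nth0 ?r i = t (h + int i)" and l: "nth0 ?l i = t (h - 1 - int i)" and q: "pfst y = q" for i
    using assms(3) by (auto simp: c)
  have tl: "nth0 (tl0 ?r) i = t (h + 1 + int i)" "nth0 (tl0 ?l) i = t (h - 2 - int i)" for i
    using r[of "Suc i"] l[of "Suc i"] by (simp_all add: algebra_simps)
  have hd: "hd0 ?l = t (h - 1)" using l[of 0] by simp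
  note T = rule_code_represents[OF assms(2,3)[unfolded c]]
  show ?thesis
  proof (cases "transition M q (t h)")
    case None
    with T assms show ?thesis by (simp add: step_code_def c)
  next
    case (Some z)
    obtain q' b m where z: "z = (q', b, m)" by (cases z)
    have "q < num_states M" "t h < num_symbols M" using assms(2) by (simp_all add: c)
    with assms(1) Some have "q' < num_states M \<and> b < num_symbols M"
      unfolding wf_tm_def z by blast
    then have "valid_config M (tm_step M c)"
      using assms(2) Some by (simp add: c z)
    moreover have "represents (step_code M y) (tm_step M c)"
    proof (cases m)
      case Move_Left
      have "nth0 (cons0 (t (h - 1)) (cons0 b (tl0 ?r))) i = (t(h := b)) (h - 1 + int i)" for i
        by (cases i; cases "i - 1") (auto simp: tl algebra_simps)
      with Move_Left T Some show ?thesis by (simp add: c z step_code_def Let_def hd tl algebra_simps)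
    next
      case Stay
      have "nth0 (cons0 b (tl0 ?r)) i = (t(h := b)) (h + int i)" for i
        by (cases i) (auto simp: tl algebra_simps)
      with Stay T Some show ?thesis by (simp add: c z step_code_def Let_def l)
    next
      case Move_Right
      have "nth0 (cons0 b ?l) i = (t(h := b)) (h - int i)" for i
        by (cases i) (auto simp: l algebra_simps)
      with Move_Right T Some show ?thesis by (simp add: c z step_code_def Let_def tl)
    qed
    ultimately show ?thesis ..
  qed
qed

definition init_code :: "nat \<Rightarrow> nat" where
  "init_code x = pair 0 (pair 0 ((cons0 1 ^^ x) 0))"

definition run_code :: "turing_machine \<Rightarrow> nat \<Rightarrow> nat \<Rightarrow> nat" where
  "run_code M x n = (step_code M ^^ n) (init_code x)"

lemma pr_run_code: "pr f \<Longrightarrow> pr g \<Longrightarrow> pr (\<lambda>x. run_code M (f x) (g x))"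
proof -
  assume fg: "pr f" "pr g"
  have "pr (\<lambda>c. cons0 1 c)" by (intro pr_list_intros)
  then have "pr (cons0 1)" by simp
  then show ?thesis
    unfolding run_code_def init_code_def by (intro pr_funpow pr_step_code pr_basic fg)
qed

lemma represents_run:
  assumes "wf_tm M"
  shows "valid_config M ((tm_step M ^^ n) (tm_initial x)) \<and>
    represents (run_code M x n) ((tm_step M ^^ n) (tm_initial x))"
proof (induction n)
  case 0
  have "nth0 ((cons0 (Suc 0) ^^ x) 0) i = (if i < x then 1 else 0)" for i
    by (induction x arbitrary: i; case_tac i) auto
  then show ?case
    using assms by (auto simp: run_code_def init_code_def tm_initial_def wf_tm_def)
next
  case (Suc n)
  then show ?case
    using represents_step[OF assms conjunct1[OF Suc] conjunct2[OF Suc]] by (simp add: run_code_def)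
qed

definition halted_code :: "turing_machine \<Rightarrow> nat \<Rightarrow> bool" where
  "halted_code M y \<longleftrightarrow> rule_code M (pair (pfst y) (hd0 (psnd (psnd y)))) = 0"

lemma decidable_halted_code: "pr f \<Longrightarrow> decidable (\<lambda>x. halted_code M (f x))"
  unfolding halted_code_def by (intro decidable_intros pr_list_intros pr_comp[OF pr_rule_code])

lemma halted_run:
  assumes "wf_tm M"
  shows "halted_code M (run_code M x n) \<longleftrightarrow> tm_halted M ((tm_step M ^^ n) (tm_initial x))"
proof -
  obtain q t h where c: "(tm_step M ^^ n) (tm_initial x) = (q, t, h)" by (cases "(tm_step M ^^ n) (tm_initial x)")
  show ?thesis
    unfolding halted_code_def c using rule_code_represents[of M q t h "run_code M x n"] represents_run[OF assms, of n x]
    by (simp add: c split: option.splits)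
qed

theorem semidecidable_if_recursively_enumerable:
  assumes "recursively_enumerable A"
  shows "semidecidable (\<lambda>x. x \<in> A)"
proof -
  obtain M where M: "wf_tm M" "\<And>x. x \<in> A \<longleftrightarrow> (\<exists>c. tm_halts_in M x c)"
    using assms unfolding recursively_enumerable_def by blast
  have "x \<in> A \<longleftrightarrow> (\<exists>n. halted_code M (run_code M x n))" for x
    unfolding M(2) tm_halts_in_def halted_run[OF M(1)] by blast
  then show ?thesis
    by simp (intro semidecidable_ex_decidable decidable_halted_code pr_run_code pr_basic)
qed

lemma tm_halts_in_unique:
  assumes "tm_halts_in M x c" "tm_halts_in M x d"
  shows "c = d"
proof -
  have *: "(tm_step M ^^ m) (tm_initial x) = (tm_step M ^^ n) (tm_initial x)"
    if "n \<le> m" "tm_halted M ((tm_step M ^^ n) (tm_initial x))" for m n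
    using that tm_step_funpow_halted[OF that(2), of "m - n"] funpow_add[of "m - n" n "tm_step M"] by simp
  show ?thesis
    using assms * unfolding tm_halts_in_def by (metis nat_le_linear)
qed

lemma tm_output_unique: "tm_output c y \<Longrightarrow> tm_output c y' \<Longrightarrow> y = y'"
  by (cases c) (metis nat_neq_iff tm_output.simps zero_neq_one)

text \<open>A computable function need not be primitive recursive, so the distances of the metric
  space enter through this graph: a halting time is searched for and the output is read off the
  coded tape.\<close>

theorem semidecidable_graph:
  assumes "computable_fun f"
  shows "semidecidable (\<lambda>p. f (pfst p) = psnd p)"
proof -
  obtain M where M: "wf_tm M" "\<And>x. \<exists>c. tm_halts_in M x c \<and> tm_output c (f x)"
    using assms unfolding computable_fun_def by blast
  let ?out = "\<lambda>y v. (\<forall>i<v. nth0 (psnd (psnd y)) i = 1) \<and> nth0 (psnd (psnd y)) v = 0"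
  have out: "?out (run_code M x n) v \<longleftrightarrow> tm_output ((tm_step M ^^ n) (tm_initial x)) v" for x n v
  proof -
    obtain q t h where c: "(tm_step M ^^ n) (tm_initial x) = (q, t, h)" by (cases "(tm_step M ^^ n) (tm_initial x)")
    then show ?thesis using represents_run[OF M(1), of n x] by (simp add: c)
  qed
  have "f x = v \<longleftrightarrow> (\<exists>n. halted_code M (run_code M x n) \<and> ?out (run_code M x n) v)" for x v
    unfolding halted_run[OF M(1)] out
    using M(2)[of x] tm_halts_in_unique tm_output_unique unfolding tm_halts_in_def by metis
  then have "semidecidable (\<lambda>p. f (pfst p) = psnd p) = semidecidable
      (\<lambda>p. \<exists>n. halted_code M (run_code M (pfst p) n) \<and> ?out (run_code M (pfst p) n) (psnd p))"
    by simp
  moreover have "semidecidable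
      (\<lambda>p. \<exists>n. halted_code M (run_code M (pfst p) n) \<and> ?out (run_code M (pfst p) n) (psnd p))"
    by (intro semidecidable_ex_decidable decidable_intros decidable_halted_code pr_run_code pr_list_intros)
  ultimately show ?thesis by simp
qed

section \<open>Codes of words\<close>

lemma prod_encode_pair: "prod_encode (x, y) = pair x y"
  by (simp add: pair_def)

lemma list_encode_Cons: "list_encode (x # xs) = cons0 x (list_encode xs)"
  by (simp add: cons0_def pair_def)

lemma list_decode_cons0 [simp]: "list_decode (cons0 x c) = x # list_decode c"
  by (simp add: cons0_def pair_def)

lemma funpow_tl0: "(tl0 ^^ i) (list_encode v) = list_encode (drop i v)"
proof (induction v arbitrary: i)
  case Nil show ?case by (induction i) auto
next
  case (Cons x xs)
  show ?case
    by (cases i) (simp_all add: list_encode_Cons Cons funpow_Suc_right del: funpow.simps list_encode.simps)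
qed

lemma nth0_list_encode: "nth0 (list_encode v) i = (if i < length v then v ! i else 0)"
proof (induction v arbitrary: i)
  case (Cons x xs)
  then show ?case by (cases i) (simp_all add: list_encode_Cons del: list_encode.simps)
qed simp

lemma length_le_list_encode: "length v \<le> list_encode v"
proof (induction v)
  case (Cons x xs)
  then show ?case using le_prod_encode_2[of "list_encode xs" x] by simp
qed simp

text \<open>The first conjunct is the bounds check, as only the empty list has code 0; without it
  the default value of \<open>nth0\<close> would pass for an entry.\<close>

definition has_entry :: "nat \<Rightarrow> nat \<Rightarrow> nat \<Rightarrow> bool" where
  "has_entry c i b \<longleftrightarrow> (tl0 ^^ i) c \<noteq> 0 \<and> nth0 c i = b"

lemma has_entry_iff: "has_entry c i b \<longleftrightarrow> i < length (list_decode c) \<and> list_decode c ! i = b"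
proof -
  have "(tl0 ^^ i) c \<noteq> 0 \<longleftrightarrow> i < length (list_decode c)"
    using funpow_tl0[of i "list_decode c"] list_encode_eq[of "drop i (list_decode c)" "[]"] by auto
  moreover have "nth0 c i = list_decode c ! i" if "i < length (list_decode c)"
    using nth0_list_encode[of "list_decode c" i] that by simp
  ultimately show ?thesis unfolding has_entry_def by auto
qed

lemma decidable_has_entry: "pr f \<Longrightarrow> pr g \<Longrightarrow> pr h \<Longrightarrow> decidable (\<lambda>x. has_entry (f x) (g x) (h x))"
  using pr_tl0[OF pr_id] unfolding has_entry_def by (intro decidable_intros pr_list_intros pr_funpow) simp_all

lemma less_list_encode: "x \<in> set v \<Longrightarrow> x < list_encode v"
proof (induction v)
  case (Cons a v)
  then show ?case
    using le_prod_encode_1[of a "list_encode v"] le_prod_encode_2[of "list_encode v" a] by fastforce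
qed simp

text \<open>Positions and letters of a word are smaller than its code, so bounded quantifiers
  suffice and the test is primitive recursive.\<close>

lemma list_decode_in_lists: "list_decode c \<in> lists {..<k} \<longleftrightarrow> (\<forall>i<c. \<forall>b<c. has_entry c i b \<longrightarrow> b < k)"
proof -
  have "x < c" if "x \<in> set (list_decode c)" for x
    using less_list_encode[OF that] by simp
  moreover have "length (list_decode c) \<le> c" using length_le_list_encode[of "list_decode c"] by simp
  ultimately show ?thesis
    unfolding has_entry_iff in_lists_conv_set by (metis in_set_conv_nth lessThan_iff order_less_le_trans)
qed

lemma decidable_in_lists: "pr f \<Longrightarrow> decidable (\<lambda>x. list_decode (f x) \<in> lists {..<k})"
proof (rule decidable_comp)
  show "decidable (\<lambda>c. list_decode c \<in> lists {..<k})"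
    unfolding list_decode_in_lists by (intro decidable_intros decidable_has_entry pr_intros)
qed

lemma re_wordsI:
  assumes "semidecidable (\<lambda>c. list_decode c \<in> L)"
  shows "re_words L"
proof -
  have "list_encode ` L = {c. list_decode c \<in> L}"
    by (auto intro: image_eqI[where x="list_decode _"])
  then show ?thesis
    using recursively_enumerable_if_semidecidable[OF assms] unfolding re_words_def by simp
qed

lemma re_wordsD:
  assumes "re_words L"
  shows "semidecidable (\<lambda>c. list_decode c \<in> L)"
proof -
  have "c \<in> list_encode ` L \<longleftrightarrow> list_decode c \<in> L" for c
    by (auto intro: image_eqI[where x="list_decode _"])
  then show ?thesis
    using semidecidable_if_recursively_enumerable[OF assms[unfolded re_words_def]] by simp
qed

lemma re_word_pairsI:
  assumes "semidecidable (\<lambda>p. (list_decode (pfst p), list_decode (psnd p)) \<in> P)"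
  shows "re_word_pairs P"
proof -
  have "(\<lambda>(w, v). prod_encode (list_encode w, list_encode v)) ` P
    = {p. (list_decode (pfst p), list_decode (psnd p)) \<in> P}"
    by (auto simp: prod_encode_pair intro!: image_eqI[where x="(list_decode _, list_decode _)"])
  then show ?thesis
    using recursively_enumerable_if_semidecidable[OF assms] unfolding re_word_pairs_def by simp
qed

definition rev_filter_step :: "nat \<Rightarrow> nat \<Rightarrow> nat" where
  "rev_filter_step k y = (if pfst y = 0 then y
     else pair (tl0 (pfst y)) (if hd0 (pfst y) < k then cons0 (hd0 (pfst y)) (psnd y) else psnd y))"

text \<open>Reversal onto an accumulator is what plain iteration yields; \<open>c\<close> rounds
  suffice because a word is no longer than its code.\<close>

definition rev_filter :: "nat \<Rightarrow> nat \<Rightarrow> nat \<Rightarrow> nat" where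
  "rev_filter k c d = psnd ((rev_filter_step k ^^ c) (pair c d))"

lemma list_decode_rev_filter:
  "list_decode (rev_filter k c d) = rev (filter (\<lambda>i. i < k) (list_decode c)) @ list_decode d"
proof -
  have "(rev_filter_step k ^^ n) (pair (list_encode v) d) =
      pair 0 (list_encode (rev (filter (\<lambda>i. i < k) v) @ list_decode d))" if "length v \<le> n" for n v
    using that
  proof (induction n arbitrary: v d)
    case (Suc n)
    show ?case
    proof (cases v)
      case Nil
      then have "rev_filter_step k (pair (list_encode v) d) = pair (list_encode v) d"
        by (simp add: rev_filter_step_def)
      then show ?thesis using Nil Suc.IH[of v d] by (simp add: funpow_Suc_right del: funpow.simps)
    next
      case (Cons x xs)
      then have "rev_filter_step k (pair (list_encode v) d) =
          pair (list_encode xs) (if x < k then cons0 x d else d)"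
        by (simp add: rev_filter_step_def list_encode_Cons del: list_encode.simps) (simp add: cons0_def)
      then show ?thesis
        using Cons Suc by (simp add: funpow_Suc_right del: funpow.simps list_encode.simps)
    qed
  qed simp
  from this[of "list_decode c" c] show ?thesis
    using length_le_list_encode[of "list_decode c"] by (simp add: rev_filter_def)
qed

lemma pr_rev_filter: "pr f \<Longrightarrow> pr g \<Longrightarrow> pr (\<lambda>x. rev_filter k (f x) (g x))"
proof -
  assume fg: "pr f" "pr g"
  have "pr (\<lambda>y. rev_filter_step k y)"
    unfolding rev_filter_step_def by (intro pr_if decidable_intros pr_list_intros)
  then show ?thesis unfolding rev_filter_def by (intro pr_psnd pr_funpow pr_pair fg) simp
qed

section \<open>Codes of group elements\<close>

context group
begin

lemma word_value_closed:
  "set ss \<subseteq> carrier G \<Longrightarrow> w \<in> lists {..<length ss} \<Longrightarrow> word_value G ss w \<in> carrier G"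
  by (induction w) (auto simp: word_value_def subset_iff)

lemma word_value_append:
  "set ss \<subseteq> carrier G \<Longrightarrow> u \<in> lists {..<length ss} \<Longrightarrow> v \<in> lists {..<length ss} \<Longrightarrow>
    word_value G ss (u @ v) = word_value G ss u \<otimes> word_value G ss v"
proof (induction u)
  case Nil
  then show ?case using word_value_closed[of ss v] by (simp add: word_value_def)
next
  case (Cons i u)
  then have "ss ! i \<in> carrier G" by (auto simp: subset_iff)
  then show ?case
    using Cons word_value_closed[of ss u] word_value_closed[of ss v] by (simp add: word_value_def m_assoc)
qed

lemma word_value_surj:
  assumes "set ss \<subseteq> carrier G" "\<forall>s\<in>set ss. inv s \<in> set ss" "g \<in> generate G (set ss)"
  shows "\<exists>w\<in>lists {..<length ss}. word_value G ss w = g"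
proof -
  have letter: "\<exists>w\<in>lists {..<length ss}. word_value G ss w = s" if s: "s \<in> set ss" for s
  proof -
    obtain i where "i < length ss" "ss ! i = s" using s by (auto simp: in_set_conv_nth)
    then show ?thesis using s assms(1) by (intro bexI[of _ "[i]"]) (auto simp: word_value_def)
  qed
  show ?thesis using assms(3)
  proof induction
    case one show ?case by (intro bexI[of _ "[]"]) (auto simp: word_value_def)
  next
    case (eng h1 h2)
    then show ?case using word_value_append[OF assms(1)] by (metis append_in_lists_conv)
  qed (use letter assms(2) in auto)
qed

text \<open>Letters beyond the generators are read as the identity, so that every number codes an element.\<close>

lemma group_coding:
  assumes "recursively_presented G"
  obtains e :: "nat \<Rightarrow> 'a" and S where "finite S" "S \<subseteq> carrier G" "generate G S = carrier G"
    "range e = carrier G" "semidecidable (\<lambda>p. e (pfst p) = e (psnd p))"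
    "\<And>s. s \<in> S \<Longrightarrow> \<exists>r. pr r \<and> (\<forall>c. e (r c) = e c \<otimes> s)"
    "\<And>g. g \<in> carrier G \<Longrightarrow> \<exists>l. pr l \<and> (\<forall>c. e (l c) = g \<otimes> e c)"
proof -
  obtain ss where ss: "set ss \<subseteq> carrier G" "\<forall>s\<in>set ss. inv s \<in> set ss"
      "generate G (set ss) = carrier G"
      and wp: "re_words {w \<in> lists {..<length ss}. word_value G ss w = \<one>}"
    using assms unfolding recursively_presented_def by blast
  let ?k = "length ss"
  let ?W = "lists {..<?k}"
  let ?f = "\<lambda>w. filter (\<lambda>i. i < ?k) w"
  define e where "e c = word_value G ss (?f (list_decode c))" for c
  have f: "?f w \<in> ?W" for w by auto
  have f_id: "?f w = w" if "w \<in> ?W" for w using that by (induction w) auto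
  have e_enc: "e (list_encode w) = word_value G ss w" if "w \<in> ?W" for w
    using f_id[OF that] by (simp add: e_def)
  have e_closed: "e c \<in> carrier G" for c
    unfolding e_def using word_value_closed[OF ss(1) f] .
  have surj: "\<exists>w\<in>?W. word_value G ss w = g" if "g \<in> carrier G" for g
    using word_value_surj[OF ss(1,2)] ss(3) that by simp
  \<comment> \<open>Reversing twice restores the order, so this concatenates the filtered
    words.\<close>
  define app where "app c d = rev_filter ?k (rev_filter ?k c 0) (rev_filter ?k (rev_filter ?k d 0) 0)" for c d
  have app: "list_decode (app c d) = ?f (list_decode c) @ ?f (list_decode d)" for c d
    by (simp add: app_def list_decode_rev_filter rev_filter[symmetric])
  have e_app: "word_value G ss (list_decode (app c d)) = e c \<otimes> e d" for c d
    unfolding app e_def by (rule word_value_append[OF ss(1) f f])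
  let ?W1 = "{w \<in> ?W. word_value G ss w = \<one>}"
  have app_W1: "list_decode (app c d) \<in> ?W1 \<longleftrightarrow> e c \<otimes> e d = \<one>" for c d
    using e_app[of c d] app[of c d] f by auto
  \<comment> \<open>Only words for the identity can be recognised, so equality is tested by
    searching for a common right inverse \<open>u\<close>; no inverse of a word has to be
    computed.\<close>
  have e_eq: "e c = e d \<longleftrightarrow> (\<exists>u. list_decode (app c u) \<in> ?W1 \<and> list_decode (app d u) \<in> ?W1)" for c d
  proof
    assume "e c = e d"
    obtain w where "w \<in> ?W" "word_value G ss w = inv (e c)" using surj[of "inv (e c)"] e_closed by auto
    then have "e c \<otimes> e (list_encode w) = \<one>" using e_enc e_closed r_inv by simp
    then show "\<exists>u. list_decode (app c u) \<in> ?W1 \<and> list_decode (app d u) \<in> ?W1"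
      unfolding app_W1 using \<open>e c = e d\<close> by auto
  next
    assume "\<exists>u. list_decode (app c u) \<in> ?W1 \<and> list_decode (app d u) \<in> ?W1"
    then obtain u where "e c \<otimes> e u = \<one>" "e d \<otimes> e u = \<one>" unfolding app_W1 by blast
    then show "e c = e d" using e_closed inv_equality by (metis inv_inv)
  qed
  show ?thesis
  proof (rule that[of "set ss" e])
    show "range e = carrier G"
      using e_closed surj e_enc by (metis image_subset_iff rangeI subsetI subset_antisym)
    have "semidecidable (\<lambda>p. \<exists>u. list_decode (app (pfst p) u) \<in> ?W1 \<and> list_decode (app (psnd p) u) \<in> ?W1)"
      unfolding app_def
      by (intro semidecidable_intros semidecidable_comp[OF re_wordsD[OF wp]] pr_rev_filter pr_basic)
    then show "semidecidable (\<lambda>p. e (pfst p) = e (psnd p))" unfolding e_eq .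
  next
    fix s assume "s \<in> set ss"
    then obtain j where j: "j < ?k" "ss ! j = s" by (auto simp: in_set_conv_nth)
    then have "s \<in> carrier G" using ss(1) \<open>s \<in> set ss\<close> by auto
    then have e_j: "e (cons0 j 0) = s" using j by (simp add: e_def word_value_def)
    have "e (app c d) = e c \<otimes> e d" for c d
      using e_app[of c d] app[of c d] by (simp add: e_def)
    then have "\<forall>c. e (app c (cons0 j 0)) = e c \<otimes> s" using e_j by simp
    moreover have "pr (\<lambda>c. app c (cons0 j 0))"
      unfolding app_def by (intro pr_rev_filter pr_list_intros)
    ultimately show "\<exists>r. pr r \<and> (\<forall>c. e (r c) = e c \<otimes> s)"
      by (intro exI[of _ "\<lambda>c. app c (cons0 j 0)"]) simp
  next
    fix g assume "g \<in> carrier G"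
    then obtain w where w: "w \<in> ?W" "word_value G ss w = g" using surj by blast
    let ?l = "\<lambda>c. foldr cons0 w c"
    have "list_decode (?l c) = w @ list_decode c" for c by (induction w) auto
    then have "e (?l c) = g \<otimes> e c" for c
      unfolding e_def using w word_value_append[OF ss(1) w(1) f] f_id[OF w(1)] by simp
    moreover have "pr ?l" by (induction w) (auto intro: pr_list_intros)
    ultimately show "\<exists>l. pr l \<and> (\<forall>c. e (l c) = g \<otimes> e c)" by (intro exI[of _ ?l]) simp
  qed (use ss in auto)
qed

end

section \<open>Formally disjoint balls\<close>

definition rat_value :: "nat \<Rightarrow> real" where
  "rat_value y = of_rat (nat_to_rat_surj y)"

text \<open>\<open>int_decode\<close> sends \<open>2 * n\<close> to \<open>n\<close> and
  \<open>2 * n - 1\<close> to \<open>- n\<close> for positive \<open>n\<close>. The two cases are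
  quotients whose numerator and denominator are both nonnegative or both negative, so the signs
  cancel.\<close>

definition fraction_code :: "nat \<Rightarrow> nat \<Rightarrow> nat \<Rightarrow> bool" where
  "fraction_code y N D \<longleftrightarrow> D > 0 \<and>
     (pfst y = 2 * N \<and> psnd y = 2 * D \<or> pfst y + 1 = 2 * N \<and> psnd y + 1 = 2 * D)"

lemma int_decode_even: "int_decode (2 * n) = int n"
  by (simp add: int_decode_def sum_decode_def)

lemma int_decode_odd: "m + 1 = 2 * n \<Longrightarrow> int_decode m = - int n"
proof -
  assume "m + 1 = 2 * n"
  then obtain k where "n = Suc k" "m = 2 * k + 1" by (cases n) auto
  then show ?thesis by (simp add: int_decode_def sum_decode_def)
qed

lemma rat_value_eq: "rat_value y = of_int (int_decode (pfst y)) / of_int (int_decode (psnd y))"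
proof -
  have "nat_to_rat_surj y = of_int (int_decode (pfst y)) / of_int (int_decode (psnd y))"
    by (simp add: nat_to_rat_surj_def pfst_def psnd_def case_prod_beta Fract_of_int_quotient)
  then show ?thesis by (simp add: rat_value_def of_rat_divide)
qed

lemma rat_value_fraction: "fraction_code y N D \<Longrightarrow> rat_value y = real N / real D"
  unfolding fraction_code_def rat_value_eq
  by (elim conjE disjE) (simp_all add: int_decode_even int_decode_odd)

lemma fraction_code_exists:
  assumes "rat_value y > 0"
  shows "\<exists>N D. fraction_code y N D"
proof -
  have dec: "int_decode m \<noteq> 0 \<Longrightarrow> (\<exists>n>0. m = 2 * n \<and> int_decode m > 0) \<or> (\<exists>n>0. m + 1 = 2 * n \<and> int_decode m < 0)" for m
  proof (cases "even m")
    case True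
    then obtain n where "m = 2 * n" by (elim evenE)
    then show "int_decode m \<noteq> 0 \<Longrightarrow> ?thesis" using int_decode_even[of n] by auto
  next
    case False
    then obtain n where "m = 2 * n + 1" by (elim oddE)
    then show ?thesis using int_decode_odd[of m "Suc n"] by (intro disjI2 exI[of _ "Suc n"]) auto
  qed
  show ?thesis
    using assms dec[of "pfst y"] dec[of "psnd y"] unfolding fraction_code_def rat_value_eq
    by (cases "int_decode (pfst y) = 0"; cases "int_decode (psnd y) = 0")
      (auto simp: zero_less_divide_iff)
qed

text \<open>The inequality of \<open>gap_code_iff\<close> with denominators cleared, which leaves a
  decidable comparison of natural numbers.\<close>

definition gap_code :: "nat \<Rightarrow> nat \<Rightarrow> nat \<Rightarrow> nat \<Rightarrow> nat \<Rightarrow> nat \<Rightarrow> bool" where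
  "gap_code y m p q p' q' \<longleftrightarrow> (\<exists>N D. fraction_code y N D \<and>
     D * (Suc q * Suc q' + 2 ^ m * (Suc p * Suc q' + Suc p' * Suc q)) \<le> N * 2 ^ m * (Suc q * Suc q'))"

lemma quotient_le:
  fixes a b c d :: real
  shows "b > 0 \<Longrightarrow> d > 0 \<Longrightarrow> a / b \<le> c / d \<longleftrightarrow> a * d \<le> c * b"
  by (simp add: field_simps)

lemma gap_code_iff:
  "gap_code y m p q p' q' \<longleftrightarrow>
     1 / 2 ^ m + real (Suc p) / real (Suc q) + real (Suc p') / real (Suc q') \<le> rat_value y"
proof -
  let ?s = "1 / 2 ^ m + real (Suc p) / real (Suc q) + real (Suc p') / real (Suc q')"
  have *: "D * (Suc q * Suc q' + 2 ^ m * (Suc p * Suc q' + Suc p' * Suc q)) \<le> N * 2 ^ m * (Suc q * Suc q')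
      \<longleftrightarrow> ?s \<le> real N / real D" if "D > 0" for N D
  proof -
    let ?Q = "real (Suc q)" and ?Q' = "real (Suc q')" and ?P = "real (Suc p)" and ?P' = "real (Suc p')"
    have "?s = (?Q * ?Q' + 2 ^ m * (?P * ?Q' + ?P' * ?Q)) / (2 ^ m * (?Q * ?Q'))"
      by (simp add: divide_simps del: of_nat_Suc) (simp add: algebra_simps)
    then have "?s \<le> real N / real D \<longleftrightarrow>
        (?Q * ?Q' + 2 ^ m * (?P * ?Q' + ?P' * ?Q)) * real D \<le> real N * (2 ^ m * (?Q * ?Q'))"
      using that by (simp only:) (rule quotient_le, simp_all)
    also have "\<dots> \<longleftrightarrow> real (D * (Suc q * Suc q' + 2 ^ m * (Suc p * Suc q' + Suc p' * Suc q)))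
        \<le> real (N * 2 ^ m * (Suc q * Suc q'))"
      by (simp only: of_nat_mult of_nat_add of_nat_power of_nat_numeral mult_ac)
    finally show ?thesis by (simp only: of_nat_le_iff)
  qed
  have "?s > 0" by (intro add_pos_pos) auto
  show ?thesis
  proof
    assume "gap_code y m p q p' q'"
    then obtain N D where ND: "fraction_code y N D"
      "D * (Suc q * Suc q' + 2 ^ m * (Suc p * Suc q' + Suc p' * Suc q)) \<le> N * 2 ^ m * (Suc q * Suc q')"
      unfolding gap_code_def by blast
    then have "D > 0" by (simp add: fraction_code_def)
    with ND(2) show "?s \<le> rat_value y" unfolding rat_value_fraction[OF ND(1)] by (simp only: *)
  next
    assume s: "?s \<le> rat_value y"
    with \<open>?s > 0\<close> have "rat_value y > 0" by linarith
    then obtain N D where ND: "fraction_code y N D" using fraction_code_exists by blast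
    then have "D > 0" by (simp add: fraction_code_def)
    with s have "D * (Suc q * Suc q' + 2 ^ m * (Suc p * Suc q' + Suc p' * Suc q)) \<le> N * 2 ^ m * (Suc q * Suc q')"
      unfolding rat_value_fraction[OF ND] by (simp only: *)
    with ND show "gap_code y m p q p' q'" unfolding gap_code_def by blast
  qed
qed

lemma basic_ball_eq: "basic_ball Z s n =
    Metric_space.mball (mspace Z) (mdist Z) (s (pfst n)) (real (Suc (pfst (psnd n))) / real (Suc (psnd (psnd n))))"
  by (simp add: basic_ball_def pfst_def psnd_def case_prod_beta Let_def)

text \<open>Disjointness of balls is not semidecidable in general. \<open>F\<close> demands more:
  the approximate distance of the centres exceeds the sum of the radii by at least the error bound
  \<open>1 / 2 ^ m\<close>.\<close>

lemma formally_disjoint_balls: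
  assumes "computable_metric_space Z s"
  obtains F where "semidecidable F"
    "\<And>a b. F (pair a b) \<Longrightarrow> basic_ball Z s a \<inter> basic_ball Z s b = {}"
    "\<And>x y. x \<in> mspace Z \<Longrightarrow> y \<in> mspace Z \<Longrightarrow> x \<noteq> y \<Longrightarrow>
       \<exists>a b. F (pair a b) \<and> x \<in> basic_ball Z s a \<and> y \<in> basic_ball Z s b"
proof -
  interpret Metric_space "mspace Z" "mdist Z" by (rule Metric_space_mspace_mdist)
  obtain r where s: "range s \<subseteq> mspace Z" "mtopology_of Z closure_of range s = mspace Z"
    and r: "computable_fun r"
    "\<And>i j n. \<bar>mdist Z (s i) (s j) - rat_value (r (pair i (pair j n)))\<bar> \<le> 1 / 2 ^ n"
    using assms unfolding computable_metric_space_def prod_encode_pair rat_value_def by blast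
  let ?near = "\<lambda>a b m y. gap_code y m (pfst (psnd a)) (psnd (psnd a)) (pfst (psnd b)) (psnd (psnd b))"
  define F where "F n \<longleftrightarrow> (\<exists>m y. r (pair (pfst (pfst n)) (pair (pfst (psnd n)) m)) = y \<and> ?near (pfst n) (psnd n) m y)" for n
  have near: "?near a b m y \<longleftrightarrow> 1 / 2 ^ m + real (Suc (pfst (psnd a))) / real (Suc (psnd (psnd a)))
     + real (Suc (pfst (psnd b))) / real (Suc (psnd (psnd b))) \<le> rat_value y" for a b m y
    by (rule gap_code_iff)
  have graph: "semidecidable (\<lambda>x. r (f x) = g x)" if "pr f" "pr g" for f g
    using semidecidable_comp[OF semidecidable_graph[OF r(1)] pr_pair[OF that]] by simp
  show ?thesis
  proof (rule that[of F])
    show "semidecidable F"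
      unfolding F_def[abs_def] gap_code_def fraction_code_def
      by (intro semidecidable_intros graph semidecidable_if_decidable decidable_intros pr_intros)
  next
    fix a b assume "F (pair a b)"
    then obtain m where "?near a b m (r (pair (pfst a) (pair (pfst b) m)))"
      unfolding F_def by auto
    then have *: "real (Suc (pfst (psnd a))) / real (Suc (psnd (psnd a)))
     + real (Suc (pfst (psnd b))) / real (Suc (psnd (psnd b))) \<le> mdist Z (s (pfst a)) (s (pfst b))"
      unfolding near using r(2)[of "pfst a" "pfst b" m] by (simp add: abs_le_iff)
    show "basic_ball Z s a \<inter> basic_ball Z s b = {}"
    proof (rule ccontr)
      assume "basic_ball Z s a \<inter> basic_ball Z s b \<noteq> {}"
      then obtain x where x: "x \<in> basic_ball Z s a" "x \<in> basic_ball Z s b" by blast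
      then have "mdist Z (s (pfst a)) (s (pfst b)) \<le> mdist Z (s (pfst a)) x + mdist Z (s (pfst b)) x"
        unfolding basic_ball_eq in_mball using triangle'[of "s (pfst a)" x "s (pfst b)"] by simp
      with x * show False unfolding basic_ball_eq in_mball by linarith
    qed
  next
    fix x y assume xy: "x \<in> mspace Z" "y \<in> mspace Z" "x \<noteq> y"
    let ?d = "mdist Z x y"
    have d: "?d > 0" using xy by simp
    \<comment> \<open>Radii and error are all below \<open>?d / 8\<close>. The centres are then more
      than \<open>6/8 * ?d\<close> apart, their approximate distance is above
      \<open>5/8 * ?d\<close>, and only \<open>3/8 * ?d\<close> is required.\<close>
    obtain q where q: "1 / real (Suc q) < ?d / 8"
      using nat_approx_posE[of "?d / 8"] d by auto
    have dense: "\<exists>i. mdist Z (s i) z < 1 / real (Suc q)" if "z \<in> mspace Z" for z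
    proof -
      have "z \<in> mtopology closure_of range s" using s(2) that by (simp add: mtopology_of_def)
      then obtain i where "s i \<in> mball z (1 / real (Suc q))"
        unfolding metric_closure_of by (auto dest!: spec[of _ "1 / real (Suc q)"])
      then show ?thesis using commute by (auto intro!: exI[of _ i])
    qed
    obtain i j where ij: "mdist Z (s i) x < 1 / real (Suc q)" "mdist Z (s j) y < 1 / real (Suc q)"
      using dense xy by meson
    have sm: "s i \<in> mspace Z" "s j \<in> mspace Z" using s(1) by auto
    obtain m where m: "1 / 2 ^ m < ?d / 8"
      using real_arch_pow_inv[of "?d / 8" "1/2"] d by (auto simp: power_one_over)
    define a b where "a = pair i (pair 0 q)" and "b = pair j (pair 0 q)"
    have "?d \<le> mdist Z (s i) x + mdist Z (s i) (s j) + mdist Z (s j) y"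
      using triangle[of x "s i" y] triangle[of "s i" "s j" y] xy sm commute[of x "s i"] by linarith
    then have "?near a b m (r (pair i (pair j m)))"
      unfolding near using ij q m r(2)[of i j m] by (simp add: a_def b_def abs_le_iff)
    then have "F (pair a b)" unfolding F_def by (auto simp: a_def b_def)
    moreover have "x \<in> basic_ball Z s a" "y \<in> basic_ball Z s b"
      unfolding basic_ball_eq in_mball using ij xy sm by (simp_all add: a_def b_def)
    ultimately show "\<exists>a b. F (pair a b) \<and> x \<in> basic_ball Z s a \<and> y \<in> basic_ball Z s b" by blast
  qed
qed

section \<open>Cantor spaces\<close>

lemma topspace_cantor_space: "topspace (cantor_space k) = {z. \<forall>i. z i < k}"
  by (auto simp: cantor_space_def PiE_def Pi_def)

lemma compact_cantor_space: "compact_space (cantor_space k)"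
  unfolding cantor_space_def
  by (simp add: compact_space_product_topology compact_space_discrete_topology)

lemma metrizable_cantor_space: "metrizable_space (cantor_space k)"
  unfolding cantor_space_def by (simp add: metrizable_space_product_topology)

text \<open>The intersection with \<open>{..<k}\<close> accounts for words with letters outside the
  alphabet, whose cylinders are empty.\<close>

lemma cylinder_eq: "cylinder k w = PiE UNIV (\<lambda>i. if i < length w then {w ! i} \<inter> {..<k} else {..<k})"
  by (auto simp: cylinder_def topspace_cantor_space PiE_def Pi_def split: if_splits)

lemma openin_cylinder: "openin (cantor_space k) (cylinder k w)"
proof -
  have "finite {i. (if i < length w then {w ! i} \<inter> {..<k} else {..<k}) \<noteq> {..<k}}"
    by (rule finite_subset[of _ "{..<length w}"]) auto
  then show ?thesis
    unfolding cylinder_eq cantor_space_def by (intro product_topology_basis) auto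
qed

lemma closedin_cylinder: "closedin (cantor_space k) (cylinder k w)"
  unfolding cylinder_eq cantor_space_def closedin_product_topology by auto

lemma cylinder_prefix:
  "z \<in> topspace (cantor_space k) \<Longrightarrow> z' \<in> cylinder k (map z [0..<N]) \<longleftrightarrow>
     z' \<in> topspace (cantor_space k) \<and> (\<forall>i<N. z' i = z i)"
  by (auto simp: cylinder_def)

lemma prefix_in_lists: "z \<in> topspace (cantor_space k) \<Longrightarrow> map z [0..<N] \<in> lists {..<k}"
  by (auto simp: topspace_cantor_space)

lemma cantor_neighbourhood:
  assumes "openin (cantor_space k) W" "z \<in> W"
  shows "\<exists>N. cylinder k (map z [0..<N]) \<subseteq> W"
proof -
  obtain U where U: "finite {i. U i \<noteq> {..<k}}" "z \<in> PiE UNIV U" "PiE UNIV U \<subseteq> W"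
    using assms unfolding cantor_space_def openin_product_topology_alt by fastforce
  then obtain N where N: "\<And>i. U i \<noteq> {..<k} \<Longrightarrow> i < N"
    by (metis (mono_tags, lifting) finite_nat_set_iff_bounded mem_Collect_eq)
  have "z \<in> topspace (cantor_space k)" using openin_subset[OF assms(1)] assms(2) by blast
  then have "cylinder k (map z [0..<N]) \<subseteq> PiE UNIV U"
    using U(2) N by (fastforce simp: cylinder_prefix topspace_cantor_space PiE_def Pi_def)
  with U(3) show ?thesis by blast
qed

lemma zero_dimensional_closed_subset:
  assumes "closedin (cantor_space k) C"
  shows "zero_dimensional (subtopology (cantor_space k) C)"
proof -
  have "cantor_space k dim_le 0"
    unfolding dimension_le_0_neighbourhood_base_of_clopen neighbourhood_base_of
  proof (intro allI impI)
    fix W z assume W: "openin (cantor_space k) W \<and> z \<in> W"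
    then obtain N where N: "cylinder k (map z [0..<N]) \<subseteq> W" using cantor_neighbourhood by blast
    have "z \<in> topspace (cantor_space k)" using W openin_subset by blast
    then have "z \<in> cylinder k (map z [0..<N])" by (simp add: cylinder_prefix)
    with N show "\<exists>U V. openin (cantor_space k) U \<and> (closedin (cantor_space k) V \<and> openin (cantor_space k) V) \<and>
        z \<in> U \<and> U \<subseteq> V \<and> V \<subseteq> W"
      by (intro exI[of _ "cylinder k (map z [0..<N])"] conjI openin_cylinder closedin_cylinder order_refl)
  qed
  moreover have "compactin (cantor_space k) C"
    using closedin_compact_space[OF compact_cantor_space assms] .
  ultimately show ?thesis
    unfolding zero_dimensional_def
    using compact_space_subtopology metrizable_space_subtopology[OF metrizable_cantor_space]
      dimension_le_subtopology by blast
qed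

lemma closedin_if_effectively_closed:
  assumes "effectively_closed k C"
  shows "closedin (cantor_space k) C"
  using assms openin_cylinder
  unfolding effectively_closed_def effectively_open_def closedin_def by (auto intro!: openin_Union)

lemma has_entry_prefix: "has_entry (list_encode (map z [0..<N])) i b \<longleftrightarrow> i < N \<and> z i = b"
  by (auto simp: has_entry_iff)

lemma has_entry_cylinder:
  "z \<in> cylinder k w \<Longrightarrow> has_entry (list_encode w) i b \<Longrightarrow> z i = b"
  by (auto simp: has_entry_iff cylinder_def)

section \<open>Group actions\<close>

text \<open>\<open>group_action\<close> maps into \<open>BijGroup E\<close>, whose elements are
  extensional on \<open>E\<close>; hence the restriction.\<close>

lemma group_action_restrict:
  assumes "group G" "\<And>g x. g \<in> carrier G \<Longrightarrow> x \<in> E \<Longrightarrow> f g x \<in> E"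
    "\<And>x. x \<in> E \<Longrightarrow> f \<one>\<^bsub>G\<^esub> x = x"
    "\<And>g h x. g \<in> carrier G \<Longrightarrow> h \<in> carrier G \<Longrightarrow> x \<in> E \<Longrightarrow> f (g \<otimes>\<^bsub>G\<^esub> h) x = f g (f h x)"
  shows "group_action G E (\<lambda>g. restrict (f g) E)"
proof -
  interpret group G by fact
  have inv: "f (inv\<^bsub>G\<^esub> g) (f g x) = x" "f g (f (inv\<^bsub>G\<^esub> g) x) = x" if "g \<in> carrier G" "x \<in> E" for g x
    using assms(3,4)[symmetric] that by simp_all
  have "bij_betw (restrict (f g) E) E E" if "g \<in> carrier G" for g
    by (rule bij_betw_byWitness[where f'="f (inv\<^bsub>G\<^esub> g)"]) (use that inv assms(2) in auto)
  then have Bij: "restrict (f g) E \<in> Bij E" if "g \<in> carrier G" for g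
    using that by (simp add: Bij_def)
  have "restrict (f (g \<otimes>\<^bsub>G\<^esub> h)) E = restrict (f g) E \<otimes>\<^bsub>BijGroup E\<^esub> restrict (f h) E"
    if "g \<in> carrier G" "h \<in> carrier G" for g h
    using that Bij assms(2,4) by (auto simp: BijGroup_def compose_def fun_eq_iff)
  then have "(\<lambda>g. restrict (f g) E) \<in> hom G (BijGroup E)"
    using Bij by (auto simp: hom_def BijGroup_def)
  then show ?thesis
    by (intro group_action.intro group_hom.intro group_hom_axioms.intro assms(1) group_BijGroup)
qed

section \<open>The symbolic extension\<close>

text \<open>
  A number \<open>pair a b\<close> satisfying \<open>F\<close> stands for two disjoint open sets \<open>B a\<close>, \<open>B b\<close>. The bit
  \<open>z (pair c n)\<close> names one of the two sets of \<open>n\<close> that the point \<open>e c \<cdot> x\<close> coded by \<open>z (pair c _)\<close>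
  avoids. Since these pairs separate points, the bits determine the point.
\<close>

definition avoided :: "nat \<Rightarrow> nat \<Rightarrow> nat" where
  "avoided n b = (if b = 0 then pfst n else psnd n)"

lemma pr_avoided: "pr f \<Longrightarrow> pr g \<Longrightarrow> pr (\<lambda>x. avoided (f x) (g x))"
  unfolding avoided_def by (intro pr_if decidable_intros pr_basic)

text \<open>The topological half of the construction, free of effectivity. The metric survives only
  in \<open>open_B\<close>, \<open>disjoint\<close> and \<open>separating\<close>.\<close>

locale coded_action = group G for G (structure) +
  fixes e :: "nat \<Rightarrow> 'a" and T :: "'z topology" and act :: "'a \<Rightarrow> 'z \<Rightarrow> 'z"
    and B :: "nat \<Rightarrow> 'z set" and F :: "nat \<Rightarrow> bool"
  assumes range_e: "range e = carrier G"
    and compact: "compact_space T"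
    and action: "group_action G (topspace T) act"
    and open_B: "openin T (B n \<inter> topspace T)"
    and disjoint: "F (pair a b) \<Longrightarrow> B a \<inter> B b = {}"
    and separating: "x \<in> topspace T \<Longrightarrow> y \<in> topspace T \<Longrightarrow> x \<noteq> y \<Longrightarrow>
      \<exists>a b. F (pair a b) \<and> x \<in> B a \<and> y \<in> B b"
begin

abbreviation "K \<equiv> topspace T"

lemma e_closed [simp]: "e c \<in> carrier G"
  using range_e by auto

lemma e_surj: "g \<in> carrier G \<Longrightarrow> \<exists>c. e c = g"
  using range_e by (metis rangeE)

lemma act_closed [simp]: "g \<in> carrier G \<Longrightarrow> x \<in> K \<Longrightarrow> act g x \<in> K"
  using group_action.element_image[OF action] by blast

lemma act_one: "x \<in> K \<Longrightarrow> act \<one> x = x"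
  using group_action.id_eq_one[OF action] by (metis restrict_apply')

lemma act_mult: "g \<in> carrier G \<Longrightarrow> h \<in> carrier G \<Longrightarrow> x \<in> K \<Longrightarrow> act (g \<otimes> h) x = act g (act h x)"
  using group_action.composition_rule[OF action] by blast

definition avoids :: "(nat \<Rightarrow> nat) \<Rightarrow> nat \<Rightarrow> 'z \<Rightarrow> bool" where
  "avoids z c x \<longleftrightarrow> (\<forall>n. F n \<longrightarrow> x \<notin> B (avoided n (z (pair c n))))"

definition consistent :: "(nat \<Rightarrow> nat) \<Rightarrow> bool" where
  "consistent z \<longleftrightarrow> (\<forall>c d n. e c = e d \<longrightarrow> z (pair c n) = z (pair d n))"

definition codes :: "(nat \<Rightarrow> nat) \<Rightarrow> 'z \<Rightarrow> bool" where
  "codes z x \<longleftrightarrow> x \<in> K \<and> (\<forall>c. avoids z c (act (e c) x))"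

definition Ext :: "(nat \<Rightarrow> nat) set" where
  "Ext = {z \<in> topspace (cantor_space 2). consistent z \<and> (\<exists>x. codes z x)}"

text \<open>A pair separating \<open>x\<close> from \<open>y\<close> has a single bit, and whichever
  of its sets this bit names contains one of the two points.\<close>

lemma avoids_unique:
  assumes "avoids z c x" "avoids z c y" "x \<in> K" "y \<in> K"
  shows "x = y"
proof (rule ccontr)
  assume "x \<noteq> y"
  then obtain a b where "F (pair a b)" "x \<in> B a" "y \<in> B b" using separating assms by blast
  then show False
    using assms(1,2) unfolding avoids_def
    by (cases "z (pair c (pair a b)) = 0") (auto simp: avoided_def dest!: spec[of _ "pair a b"])
qed

lemma codes_unique: "codes z x \<Longrightarrow> codes z y \<Longrightarrow> x = y"
proof -
  obtain c where c: "e c = \<one>" using e_surj by blast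
  assume "codes z x" "codes z y"
  then have "avoids z c x" "avoids z c y" "x \<in> K" "y \<in> K"
    unfolding codes_def using c act_one by (metis)+
  then show "x = y" by (rule avoids_unique)
qed

definition point :: "(nat \<Rightarrow> nat) \<Rightarrow> 'z" where
  "point z = (THE x. codes z x)"

lemma point_eq: "codes z x \<Longrightarrow> point z = x"
  unfolding point_def using codes_unique by blast

lemma codes_point: "z \<in> Ext \<Longrightarrow> codes z (point z)"
  unfolding Ext_def using point_eq by auto

lemma Ext_surj:
  assumes "x \<in> K"
  shows "\<exists>z\<in>Ext. point z = x"
proof -
  \<comment> \<open>The second set is named exactly when the point lies in the first, and then
    disjointness keeps the point out of the second. The bit depends on the code \<open>c\<close>
    only through \<open>e c\<close>, hence is consistent.\<close>
  define z where "z i = (if act (e (pfst i)) x \<in> B (pfst (psnd i)) then 1 else 0 :: nat)" for i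
  have "avoids z c (act (e c) x)" for c
    unfolding avoids_def
  proof (intro allI impI)
    fix n assume "F n"
    then have "B (pfst n) \<inter> B (psnd n) = {}" using disjoint[of "pfst n" "psnd n"] by simp
    then show "act (e c) x \<notin> B (avoided n (z (pair c n)))" by (auto simp: z_def avoided_def)
  qed
  then have "codes z x" using assms by (simp add: codes_def)
  moreover from this have "z \<in> Ext"
    unfolding Ext_def consistent_def by (auto simp: topspace_cantor_space z_def)
  ultimately show ?thesis using point_eq by blast
qed

text \<open>The choice of \<open>d\<close> need not be effective: on a consistent \<open>z\<close>
  all codes of the same element read the same bit, so that \<open>computable_ext_act\<close> may use
  any primitive recursive choice instead.\<close>

definition shift_index :: "'a \<Rightarrow> nat \<Rightarrow> nat" where
  "shift_index g i = pair (SOME d. e d = e (pfst i) \<otimes> g) (psnd i)"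

definition shift :: "'a \<Rightarrow> (nat \<Rightarrow> nat) \<Rightarrow> nat \<Rightarrow> nat" where
  "shift g z = (\<lambda>i. z (shift_index g i))"

lemma shift_eq:
  assumes "consistent z" "e d = e c \<otimes> g"
  shows "shift g z (pair c n) = z (pair d n)"
proof -
  have "e (SOME d. e d = e c \<otimes> g) = e c \<otimes> g" using someI[of "\<lambda>d. e d = e c \<otimes> g", OF assms(2)] .
  then show ?thesis using assms unfolding shift_def shift_index_def consistent_def by simp
qed

lemma consistent_shift:
  assumes "consistent z" "g \<in> carrier G"
  shows "consistent (shift g z)"
  unfolding consistent_def
proof (intro allI impI)
  fix c d n assume cd: "e c = e d"
  obtain f where f: "e f = e c \<otimes> g" using e_surj[of "e c \<otimes> g"] assms(2) by auto
  show "shift g z (pair c n) = shift g z (pair d n)"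
    using shift_eq[OF assms(1) f] shift_eq[OF assms(1), of f d] f cd by simp
qed

text \<open>The bits of \<open>shift g z\<close> at \<open>c\<close> are those of \<open>z\<close>
  at a code of \<open>e c \<otimes> g\<close>, and this element takes \<open>x\<close> to
  \<open>act (e c) (act g x)\<close>.\<close>

lemma codes_shift:
  assumes "consistent z" "g \<in> carrier G" "codes z x"
  shows "codes (shift g z) (act g x)"
proof -
  have x: "x \<in> K" using assms(3) by (simp add: codes_def)
  have "avoids (shift g z) c (act (e c) (act g x))" for c
  proof -
    obtain f where f: "e f = e c \<otimes> g" using e_surj[of "e c \<otimes> g"] assms(2) by auto
    have "avoids z f (act (e f) x)" using assms(3) by (simp add: codes_def)
    then show ?thesis
      unfolding avoids_def shift_eq[OF assms(1) f] using f act_mult assms(2) x by simp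
  qed
  then show ?thesis using x assms(2) by (simp add: codes_def)
qed

lemma shift_Ext:
  assumes "z \<in> Ext" "g \<in> carrier G"
  shows "shift g z \<in> Ext" "point (shift g z) = act g (point z)"
proof -
  have z: "consistent z" "z \<in> topspace (cantor_space 2)" using assms(1) by (auto simp: Ext_def)
  have c: "codes (shift g z) (act g (point z))"
    using codes_shift[OF z(1) assms(2) codes_point[OF assms(1)]] .
  then show "shift g z \<in> Ext"
    using consistent_shift[OF z(1) assms(2)] z(2)
    by (auto simp: Ext_def topspace_cantor_space shift_def)
  show "point (shift g z) = act g (point z)" using c by (rule point_eq)
qed

lemma shift_one: "z \<in> Ext \<Longrightarrow> shift \<one> z = z"
proof
  fix i assume z: "z \<in> Ext"
  have "shift \<one> z (pair (pfst i) (psnd i)) = z (pair (pfst i) (psnd i))"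
    by (rule shift_eq) (use z in \<open>auto simp: Ext_def\<close>)
  then show "shift \<one> z i = z i" by simp
qed

lemma shift_mult:
  assumes "z \<in> Ext" "g \<in> carrier G" "h \<in> carrier G"
  shows "shift (g \<otimes> h) z = shift g (shift h z)"
proof
  fix i
  have z: "consistent z" using assms(1) by (simp add: Ext_def)
  let ?c = "pfst i" and ?n = "psnd i"
  obtain d where d: "e d = e ?c \<otimes> g" using e_surj[of "e ?c \<otimes> g"] assms by auto
  obtain f where f: "e f = e d \<otimes> h" using e_surj[of "e d \<otimes> h"] assms by auto
  have "e f = e ?c \<otimes> (g \<otimes> h)" using d f assms by (simp add: m_assoc)
  then have "shift (g \<otimes> h) z (pair ?c ?n) = z (pair f ?n)" by (rule shift_eq[OF z])
  also have "\<dots> = shift h z (pair d ?n)" using shift_eq[OF z f] by simp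
  also have "\<dots> = shift g (shift h z) (pair ?c ?n)"
    by (rule shift_eq[OF consistent_shift[OF z assms(3)] d, symmetric])
  finally show "shift (g \<otimes> h) z i = shift g (shift h z) i" by (simp only: pair_pfst_psnd)
qed

section \<open>The extension as a topological system and its factor map\<close>

abbreviation "ExtT \<equiv> subtopology (cantor_space 2) Ext"

lemma topspace_ExtT [simp]: "topspace ExtT = Ext"
  by (auto simp: Ext_def)

definition ext_act :: "'a \<Rightarrow> (nat \<Rightarrow> nat) \<Rightarrow> nat \<Rightarrow> nat" where
  "ext_act g = restrict (shift g) Ext"

lemma group_action_ext_act: "group_action G Ext ext_act"
  unfolding ext_act_def
  by (intro group_action_restrict is_group shift_Ext shift_one shift_mult)

lemma continuous_map_ext_act:
  assumes "g \<in> carrier G"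
  shows "continuous_map ExtT ExtT (ext_act g)"
proof (rule continuous_map_eq)
  have "continuous_map ExtT (cantor_space 2) (shift g)"
    unfolding shift_def cantor_space_def
    by (auto simp: continuous_map_componentwise_UNIV
        intro!: continuous_map_from_subtopology continuous_map_product_projection)
  then show "continuous_map ExtT ExtT (shift g)"
    using shift_Ext(1)[OF _ assms] by (auto simp: continuous_map_in_subtopology)
qed (simp add: ext_act_def)

lemma topological_action_ext_act:
  assumes "closedin (cantor_space 2) Ext"
  shows "topological_action G ExtT ext_act"
  unfolding topological_action_def
proof (intro conjI ballI)
  show "compact_space ExtT" "metrizable_space ExtT"
    using zero_dimensional_closed_subset[OF assms] by (auto simp: zero_dimensional_def)
  show "group_action G (topspace ExtT) ext_act" unfolding topspace_ExtT by (rule group_action_ext_act)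
  fix g assume g: "g \<in> carrier G"
  have "homeomorphic_maps ExtT ExtT (ext_act g) (ext_act (inv g))"
    unfolding homeomorphic_maps_def
    using g continuous_map_ext_act group_action.orbit_sym_aux[OF group_action_ext_act g]
      group_action.orbit_sym_aux[OF group_action_ext_act, of "inv g"]
    by (metis inv_closed inv_inv topspace_ExtT)
  then show "homeomorphic_map ExtT ExtT (ext_act g)" unfolding homeomorphic_map_maps by blast
qed

text \<open>The sets named by the bits of \<open>z\<close> at the identity cover the compact
  complement of \<open>U\<close>. Finitely many of them suffice, so every \<open>z'\<close> sharing
  those finitely many bits has its point in \<open>U\<close>.\<close>

lemma continuous_map_point: "continuous_map ExtT T point"
  unfolding continuous_map
proof (intro conjI allI impI)
  show "point ` topspace ExtT \<subseteq> topspace T"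
    using codes_point by (auto simp: codes_def)
  obtain c where c: "e c = \<one>" using e_surj by blast
  have avoids: "point z \<in> K" "avoids z c (point z)" if "z \<in> Ext" for z
    using codes_point[OF that] c act_one unfolding codes_def by metis+
  fix U assume U: "openin T U"
  show "openin ExtT {z \<in> topspace ExtT. point z \<in> U}"
  proof (subst openin_subopen, intro ballI)
    fix z assume "z \<in> {z \<in> topspace ExtT. point z \<in> U}"
    then have z: "z \<in> Ext" "point z \<in> U" by auto
    let ?C = "(\<lambda>n. B (avoided n (z (pair c n))) \<inter> K) ` {n. F n}"
    have "compactin T (K - U)"
      using U by (intro closedin_compact_space[OF compact]) auto
    moreover have "K - U \<subseteq> \<Union>?C"
    proof
      fix y assume y: "y \<in> K - U"
      then have "point z \<noteq> y" using z(2) by blast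
      then have "\<not> avoids z c y" using avoids_unique[OF avoids(2)[OF z(1)] _ avoids(1)[OF z(1)]] y by blast
      then show "y \<in> \<Union>?C" using y unfolding avoids_def by blast
    qed
    ultimately obtain D where D: "finite D" "D \<subseteq> ?C" "K - U \<subseteq> \<Union>D"
      using compactinD[of T "K - U" ?C] open_B by auto
    then obtain A where A: "finite A" "A \<subseteq> {n. F n}" "D = (\<lambda>n. B (avoided n (z (pair c n))) \<inter> K) ` A"
      using finite_subset_image[OF D(1,2)] by auto
    obtain N where N: "\<And>n. n \<in> A \<Longrightarrow> pair c n < N"
      using A(1) finite_nat_set_iff_bounded[of "pair c ` A"] by auto
    let ?W = "cylinder 2 (map z [0..<N]) \<inter> Ext"
    have z2: "z \<in> topspace (cantor_space 2)" using z(1) by (simp add: Ext_def)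
    have "openin ExtT ?W" using openin_cylinder by (auto simp: openin_subtopology)
    moreover have "z \<in> ?W" using z z2 by (simp add: cylinder_prefix)
    moreover have "point z' \<in> U" if z': "z' \<in> ?W" for z'
    proof (rule ccontr)
      assume "point z' \<notin> U"
      then have "point z' \<in> \<Union>D" using D(3) avoids(1) z' by blast
      then obtain n where n: "n \<in> A" "point z' \<in> B (avoided n (z (pair c n)))" unfolding A(3) by blast
      have "z' (pair c n) = z (pair c n)" using z' N[OF n(1)] by (simp add: cylinder_prefix[OF z2])
      then show False using avoids(2)[of z'] z' n A(2) unfolding avoids_def by auto
    qed
    ultimately show "\<exists>W. openin ExtT W \<and> z \<in> W \<and> W \<subseteq> {z \<in> topspace ExtT. point z \<in> U}"
      unfolding topspace_ExtT by (intro exI[of _ ?W]) auto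
  qed
qed

lemma factor_map_point: "factor_map G ExtT ext_act T act point"
  unfolding factor_map_def
proof (intro conjI ballI)
  show "point ` topspace ExtT = topspace T"
    unfolding topspace_ExtT using codes_point Ext_surj by (force simp: codes_def)
  show "point (ext_act g z) = act g (point z)" if "g \<in> carrier G" "z \<in> topspace ExtT" for g z
    using shift_Ext(2) that by (simp add: ext_act_def)
qed (rule continuous_map_point)

end

section \<open>Effectivity of the extension\<close>

text \<open>Oddness of \<open>C div 2 ^ i\<close> is written with arithmetic and bounded quantifiers
  only, which keeps it primitive recursive.\<close>

lemma set_decode_iff: "i \<in> set_decode C \<longleftrightarrow> (\<exists>q<Suc C. \<exists>r<2 ^ i. C = (2 * q + 1) * 2 ^ i + r)"
proof
  assume "i \<in> set_decode C"
  then have "odd (C div 2 ^ i)" by (simp add: set_decode_def)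
  then obtain q where q: "C div 2 ^ i = 2 * q + 1" by (elim oddE)
  then have C: "C = (2 * q + 1) * 2 ^ i + C mod 2 ^ i" using div_mult_mod_eq[of C "2 ^ i"] by simp
  have "q \<le> C div 2 ^ i" using q by simp
  also have "\<dots> \<le> C" by (rule div_le_dividend)
  finally show "\<exists>q<Suc C. \<exists>r<2 ^ i. C = (2 * q + 1) * 2 ^ i + r"
    using C by (intro exI[of _ q] exI[of _ "C mod 2 ^ i"] conjI) (simp_all add: less_Suc_eq_le)
next
  assume "\<exists>q<Suc C. \<exists>r<2 ^ i. C = (2 * q + 1) * 2 ^ i + r"
  then obtain q r where "r < 2 ^ i" "C = (2 * q + 1) * 2 ^ i + r" by blast
  then have "C = r + (2 * q + 1) * 2 ^ i" by simp
  then have "C div 2 ^ i = 2 * q + 1 + r div 2 ^ i" using div_mult_self1[of "2 ^ i" r "2 * q + 1"] by simp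
  then have "C div 2 ^ i = 2 * q + 1" using \<open>r < 2 ^ i\<close> by simp
  then show "i \<in> set_decode C" by (simp add: set_decode_def)
qed

lemma less_if_in_set_decode: "i \<in> set_decode C \<Longrightarrow> i < C"
proof -
  assume "i \<in> set_decode C"
  then obtain q r where "C = (2 * q + 1) * 2 ^ i + r" unfolding set_decode_iff by blast
  moreover have "i < 2 ^ i" by (rule less_exp)
  moreover have "2 ^ i \<le> (2 * q + 1) * 2 ^ i + r" by (simp add: add_mult_distrib)
  ultimately show "i < C" by linarith
qed

lemma decidable_in_set_decode:
  assumes "pr f" "pr g"
  shows "decidable (\<lambda>x. f x \<in> set_decode (g x))"
proof -
  have "decidable (\<lambda>p. pfst p \<in> set_decode (psnd p))"
    unfolding set_decode_iff by (intro decidable_intros pr_intros)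
  from decidable_comp[OF this pr_pair[OF assms]] show ?thesis by simp
qed

lemma has_entry_less:
  assumes "has_entry c i b"
  shows "i < c" "b < c"
proof -
  have "i < length (list_decode c)" "b \<in> set (list_decode c)"
    using assms by (auto simp: has_entry_iff)
  then show "i < c" "b < c"
    using length_le_list_encode[of "list_decode c"] less_list_encode[of b "list_decode c"] by auto
qed

locale effective_action = coded_action +
  fixes S :: "'a set" and I :: "'a \<Rightarrow> nat \<Rightarrow> nat set" and l :: "'a \<Rightarrow> nat \<Rightarrow> nat"
  assumes finite_S: "finite S" and generate_S: "generate G S = carrier G" and one_S: "\<one> \<in> S"
    and S_carrier: "S \<subseteq> carrier G"
    and semidecidable_e: "semidecidable (\<lambda>p. e (pfst p) = e (psnd p))"
    and semidecidable_F: "semidecidable F"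
    and semidecidable_cover: "semidecidable (\<lambda>C. topspace T \<subseteq> (\<Union>n\<in>set_decode C. B n))"
    and I: "s \<in> S \<Longrightarrow> {x \<in> topspace T. act s x \<in> B m} = (\<Union>n\<in>I s m. B n) \<inter> topspace T"
    and semidecidable_I: "s \<in> S \<Longrightarrow> semidecidable (\<lambda>p. psnd p \<in> I s (pfst p))"
    and pr_l: "s \<in> S \<Longrightarrow> pr (l s)" and e_l: "s \<in> S \<Longrightarrow> e (l s c) = s \<otimes> e c"
begin

lemma S_closed [simp]: "s \<in> S \<Longrightarrow> s \<in> carrier G"
  using S_carrier by blast

text \<open>
  Membership in \<open>Ext\<close> only has to be tested along the edges \<open>(c, l s c)\<close> of the Cayley graph. In
  particular no computability of the inverses of the generators is needed.
\<close>

definition locally_coded :: "(nat \<Rightarrow> nat) \<Rightarrow> bool" where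
  "locally_coded z \<longleftrightarrow> (\<forall>s\<in>S. \<forall>c. \<exists>x\<in>K. avoids z c x \<and> avoids z (l s c) (act s x))"

text \<open>By uniqueness the local points form a function \<open>p\<close>. Consistency makes
  \<open>p c\<close> depend on \<open>e c\<close> only, every edge forces
  \<open>p (l s c) = act s (p c)\<close>, and since \<open>S\<close> generates the group,
  \<open>p\<close> is the orbit map of its value at the identity.\<close>

lemma codes_if_locally_coded:
  assumes "consistent z" "locally_coded z"
  shows "\<exists>x. codes z x"
proof -
  have "\<forall>c. \<exists>x\<in>K. avoids z c x" using assms(2) one_S unfolding locally_coded_def by blast
  then obtain p where p: "\<And>c. p c \<in> K" "\<And>c. avoids z c (p c)" by metis
  have p_cong: "p c = p d" if "e c = e d" for c d
  proof -
    have "avoids z c x \<longleftrightarrow> avoids z d x" for x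
      using assms(1) that unfolding consistent_def avoids_def by metis
    then show ?thesis using avoids_unique[of z c] p by blast
  qed
  have p_l: "p (l s c) = act s (p c)" if s: "s \<in> S" for s c
  proof -
    obtain x where x: "x \<in> K" "avoids z c x" "avoids z (l s c) (act s x)"
      using assms(2) s unfolding locally_coded_def by blast
    have "x = p c" using avoids_unique[OF x(2) p(2) x(1) p(1)] .
    moreover have "act s x = p (l s c)"
      using avoids_unique[OF x(3) p(2) _ p(1)] x(1) s by simp
    ultimately show ?thesis by simp
  qed
  have p_act: "p d = act g (p c)" if "g \<in> generate G S" "e d = g \<otimes> e c" for g c d
    using that
  proof (induction arbitrary: c d)
    case one
    then show ?case using p_cong[of d c] act_one p(1) by simp
  next
    case (incl s)
    then show ?case using p_cong[of d "l s c"] p_l e_l by simp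
  next
    \<comment> \<open>The edge from \<open>d\<close> to a code of \<open>e c\<close> is read
      backwards.\<close>
    case (inv s)
    then have s: "s \<in> carrier G" by simp
    have "e c = e (l s d)" using inv s e_l m_assoc[of s "inv s" "e c"] by simp
    then have "p c = act s (p d)" using p_cong p_l inv(1) by metis
    then show ?case using group_action.orbit_sym_aux[OF action s p(1)] by simp
  next
    case (eng g h)
    then have gh: "g \<in> carrier G" "h \<in> carrier G" using generate_S by auto
    then obtain f where f: "e f = h \<otimes> e c" using e_surj[of "h \<otimes> e c"] by auto
    have "p d = act g (p f)" using eng(3)[of d f] eng.prems f gh by (simp add: m_assoc)
    also have "p f = act h (p c)" using eng(4) f .
    finally show ?case using act_mult gh p(1) by simp
  qed
  obtain c0 where c0: "e c0 = \<one>" using e_surj by blast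
  have "p c = act (e c) (p c0)" for c
    by (rule p_act) (simp_all add: generate_S c0)
  then have "codes z (p c0)" using p unfolding codes_def by metis
  then show ?thesis ..
qed

lemma locally_coded_if_codes:
  assumes "codes z x"
  shows "locally_coded z"
  unfolding locally_coded_def
proof (intro ballI allI)
  fix s c assume s: "s \<in> S"
  have x: "x \<in> K" "\<And>c. avoids z c (act (e c) x)" using assms by (auto simp: codes_def)
  have "act s (act (e c) x) = act (e (l s c)) x" using act_mult e_l s x(1) by simp
  then show "\<exists>y\<in>K. avoids z c y \<and> avoids z (l s c) (act s y)"
    using x by (intro bexI[of _ "act (e c) x"]) auto
qed

lemma Ext_iff: "z \<in> Ext \<longleftrightarrow> z \<in> topspace (cantor_space 2) \<and> consistent z \<and> locally_coded z"
  unfolding Ext_def using codes_if_locally_coded locally_coded_if_codes by blast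

section \<open>Forbidden words and effective closedness\<close>

definition inconsistent_word :: "nat \<Rightarrow> bool" where
  "inconsistent_word v \<longleftrightarrow> (\<exists>c d n b b'. e c = e d \<and>
     has_entry v (pair c n) b \<and> has_entry v (pair d n) b' \<and> b \<noteq> b')"

text \<open>The two reasons why the \<open>i\<close>-th ball holds no point of \<open>K\<close>
  compatible with the prefix \<open>v\<close> along the edge: the bits at \<open>c\<close> name this
  ball, or \<open>s\<close> maps its points in \<open>K\<close> into a ball named by the bits at
  \<open>l s c\<close>.\<close>

definition excluded :: "'a \<Rightarrow> nat \<Rightarrow> nat \<Rightarrow> nat \<Rightarrow> bool" where
  "excluded s c v i \<longleftrightarrow>
     (\<exists>n b. F n \<and> has_entry v (pair c n) b \<and> i = avoided n b) \<or>
     (\<exists>n b. F n \<and> has_entry v (pair (l s c) n) b \<and> i \<in> I s (avoided n b))"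

text \<open>The bound \<open>i < C\<close> loses nothing, as the elements of
  \<open>set_decode C\<close> are below \<open>C\<close>; it makes the quantifier bounded and the
  condition semidecidable.\<close>

definition uncoded_word :: "nat \<Rightarrow> bool" where
  "uncoded_word v \<longleftrightarrow> (\<exists>s\<in>S. \<exists>c C. K \<subseteq> (\<Union>n\<in>set_decode C. B n) \<and>
     (\<forall>i<C. i \<notin> set_decode C \<or> excluded s c v i))"

definition forbidden :: "nat list set" where
  "forbidden = {w \<in> lists {..<2}. inconsistent_word (list_encode w) \<or> uncoded_word (list_encode w)}"

lemma re_forbidden: "re_words forbidden"
proof (rule re_wordsI)
  note e' = semidecidable_comp[OF semidecidable_e pr_pair, simplified]
  note d = semidecidable_if_decidable
  have "semidecidable inconsistent_word"
    unfolding inconsistent_word_def[abs_def]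
    by (intro semidecidable_intros e' d[OF decidable_has_entry] d[OF decidable_not] decidable_eq pr_basic)
  moreover have "semidecidable uncoded_word"
    unfolding uncoded_word_def[abs_def]
  proof (rule semidecidable_finite_ex[OF finite_S])
    fix s assume s: "s \<in> S"
    have I': "semidecidable (\<lambda>x. f x \<in> I s (g x))" if "pr f" "pr g" for f g
      using semidecidable_comp[OF semidecidable_I[OF s] pr_pair[OF that(2,1)]] by simp
    have l': "pr (\<lambda>x. l s (f x))" if "pr f" for f using pr_comp[OF pr_l[OF s] that] .
    show "semidecidable (\<lambda>v. \<exists>c C. K \<subseteq> (\<Union>n\<in>set_decode C. B n) \<and>
        (\<forall>i<C. i \<notin> set_decode C \<or> excluded s c v i))"
      unfolding excluded_def
      by (intro semidecidable_intros semidecidable_comp[OF semidecidable_cover]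
          semidecidable_comp[OF semidecidable_F] I' d[OF decidable_has_entry] d[OF decidable_eq]
          d[OF decidable_not] decidable_in_set_decode pr_avoided l' pr_basic)
  qed
  ultimately have "semidecidable (\<lambda>v. list_decode v \<in> lists {..<2} \<and> (inconsistent_word v \<or> uncoded_word v))"
    by (intro semidecidable_conj semidecidable_disj d[OF decidable_in_lists] pr_id)
  then show "semidecidable (\<lambda>v. list_decode v \<in> forbidden)"
    by (simp add: forbidden_def)
qed

lemma forbidden_cylinder:
  assumes "w \<in> forbidden" "z \<in> cylinder 2 w"
  shows "z \<notin> Ext"
proof
  assume "z \<in> Ext"
  then have z: "consistent z" "locally_coded z" by (auto simp: Ext_iff)
  note entry = has_entry_cylinder[OF assms(2)]
  have "\<not> inconsistent_word (list_encode w)"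
    using z(1) entry unfolding inconsistent_word_def consistent_def by metis
  then have "uncoded_word (list_encode w)" using assms(1) by (simp add: forbidden_def)
  then obtain s c C where C: "s \<in> S" "K \<subseteq> (\<Union>n\<in>set_decode C. B n)"
    "\<And>i. i \<in> set_decode C \<Longrightarrow> excluded s c (list_encode w) i"
    unfolding uncoded_word_def using less_if_in_set_decode by blast
  obtain x where x: "x \<in> K" "avoids z c x" "avoids z (l s c) (act s x)"
    using z(2) C(1) unfolding locally_coded_def by blast
  obtain i where i: "i \<in> set_decode C" "x \<in> B i" using C(2) x(1) by blast
  from C(3)[OF i(1)] show False
    unfolding excluded_def
  proof (elim disjE exE conjE)
    fix n b assume "F n" "has_entry (list_encode w) (pair c n) b" "i = avoided n b"
    then show False using x(2) i(2) entry unfolding avoids_def by blast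
  next
    fix n b assume n: "F n" "has_entry (list_encode w) (pair (l s c) n) b" "i \<in> I s (avoided n b)"
    then have "act s x \<in> B (avoided n b)" using I[OF C(1)] i(2) x(1) by blast
    then show False using x(3) n entry unfolding avoids_def by blast
  qed
qed

lemma excluded_prefix: "excluded s c (list_encode (map z [0..<N])) i \<longleftrightarrow>
   (\<exists>n. F n \<and> pair c n < N \<and> i = avoided n (z (pair c n))) \<or>
   (\<exists>n. F n \<and> pair (l s c) n < N \<and> i \<in> I s (avoided n (z (pair (l s c) n))))"
  unfolding excluded_def has_entry_prefix by blast

text \<open>Inconsistency shows in two coordinates. If instead no point is compatible along some
  edge, the excluded balls cover \<open>K\<close>; by compactness finitely many do, and one finite
  prefix excludes all of them.\<close>

lemma forbidden_prefix:
  assumes "z \<in> topspace (cantor_space 2)" "z \<notin> Ext"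
  shows "\<exists>N. map z [0..<N] \<in> forbidden"
proof (cases "consistent z")
  case False
  then obtain c d n where cdn: "e c = e d" "z (pair c n) \<noteq> z (pair d n)" unfolding consistent_def by blast
  have "inconsistent_word (list_encode (map z [0..<Suc (pair c n + pair d n)]))"
    unfolding inconsistent_word_def has_entry_prefix
    by (rule exI[of _ c], rule exI[of _ d], rule exI[of _ n]) (use cdn in auto)
  then show ?thesis using prefix_in_lists[OF assms(1)] unfolding forbidden_def by blast
next
  case True
  then have "\<not> locally_coded z" using assms Ext_iff by blast
  then obtain s c where s: "s \<in> S" and no: "\<And>x. x \<in> K \<Longrightarrow> avoids z c x \<Longrightarrow> \<not> avoids z (l s c) (act s x)"
    unfolding locally_coded_def by blast
  define J where "J = {i. \<exists>N. excluded s c (list_encode (map z [0..<N])) i}"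
  have "K \<subseteq> \<Union>((\<lambda>i. B i \<inter> K) ` J)"
  proof
    fix x assume x: "x \<in> K"
    show "x \<in> \<Union>((\<lambda>i. B i \<inter> K) ` J)"
    proof (cases "avoids z c x")
      case False
      then obtain n where n: "F n" "x \<in> B (avoided n (z (pair c n)))" unfolding avoids_def by blast
      then have "avoided n (z (pair c n)) \<in> J" unfolding J_def excluded_prefix by auto
      then show ?thesis using n x by blast
    next
      case True
      then obtain n where n: "F n" "act s x \<in> B (avoided n (z (pair (l s c) n)))"
        using no[OF x] unfolding avoids_def by blast
      then obtain i where i: "i \<in> I s (avoided n (z (pair (l s c) n)))" "x \<in> B i" using I[OF s] x by blast
      then have "i \<in> J" unfolding J_def excluded_prefix using n(1) by auto
      then show ?thesis using i x by blast
    qed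
  qed
  then obtain D where D: "finite D" "D \<subseteq> (\<lambda>i. B i \<inter> K) ` J" "K \<subseteq> \<Union>D"
    using compactinD[of T K "(\<lambda>i. B i \<inter> K) ` J"] compact open_B unfolding compact_space_def by auto
  obtain A where A: "A \<subseteq> J" "finite A" "D = (\<lambda>i. B i \<inter> K) ` A"
    using finite_subset_image[OF D(1,2)] by auto
  \<comment> \<open>A longer prefix still excludes the ball, so finitely many balls share one
    \<open>N\<close>.\<close>
  have "eventually (\<lambda>N. excluded s c (list_encode (map z [0..<N])) i) sequentially" if i: "i \<in> J" for i
  proof -
    obtain M where M: "excluded s c (list_encode (map z [0..<M])) i" using i unfolding J_def by blast
    have "excluded s c (list_encode (map z [0..<N])) i" if "N \<ge> M" for N
      using M order_less_le_trans[OF _ that] unfolding excluded_prefix by blast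
    then show ?thesis unfolding eventually_sequentially by blast
  qed
  then have "eventually (\<lambda>N. \<forall>i\<in>A. excluded s c (list_encode (map z [0..<N])) i) sequentially"
    using A(1,2) by (intro eventually_ball_finite) auto
  then obtain N where N: "\<forall>i\<in>A. excluded s c (list_encode (map z [0..<N])) i"
    unfolding eventually_sequentially by blast
  have A': "set_decode (set_encode A) = A" using A(2) by simp
  have "uncoded_word (list_encode (map z [0..<N]))"
    unfolding uncoded_word_def
    by (rule bexI[OF _ s], rule exI[of _ c], rule exI[of _ "set_encode A"])
      (use N D(3) in \<open>auto simp: A' A(3)\<close>)
  then show ?thesis using prefix_in_lists[OF assms(1)] unfolding forbidden_def by blast
qed

lemma effectively_closed_Ext: "effectively_closed 2 Ext"
proof -
  have "topspace (cantor_space 2) - Ext = (\<Union>w\<in>forbidden. cylinder 2 w)"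
  proof (intro equalityI subsetI)
    fix z assume z: "z \<in> topspace (cantor_space 2) - Ext"
    then obtain N where "map z [0..<N] \<in> forbidden" using forbidden_prefix by blast
    moreover have "z \<in> cylinder 2 (map z [0..<N])" using z by (simp add: cylinder_prefix)
    ultimately show "z \<in> (\<Union>w\<in>forbidden. cylinder 2 w)" by blast
  next
    fix z assume "z \<in> (\<Union>w\<in>forbidden. cylinder 2 w)"
    then show "z \<in> topspace (cantor_space 2) - Ext"
      using forbidden_cylinder by (auto simp: cylinder_def)
  qed
  moreover have "forbidden \<subseteq> lists {..<2}" by (auto simp: forbidden_def)
  moreover have "Ext \<subseteq> topspace (cantor_space 2)" by (auto simp: Ext_def)
  ultimately show ?thesis
    unfolding effectively_closed_def effectively_open_def using re_forbidden by blast
qed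

text \<open>A prefix \<open>w\<close> of the image prescribes finitely many coordinates of
  \<open>z\<close>, and \<open>v\<close> is paired with \<open>w\<close> when it already contains
  all of them. Only right multiplication of codes enters, not the computability of the action on
  \<open>K\<close>.\<close>

lemma computable_ext_act:
  assumes "g \<in> carrier G" "pr r" "\<And>c. e (r c) = e c \<otimes> g"
  shows "computable_cantor_map 2 Ext 2 (ext_act g)"
  unfolding computable_cantor_map_def
proof (intro conjI exI ballI)
  let ?i = "\<lambda>i. pair (r (pfst i)) (psnd i)"
  \<comment> \<open>Entries and their positions lie below the code \<open>w\<close>, so these bounds
    are harmless and make the relation decidable.\<close>
  let ?Q = "\<lambda>w v. \<forall>i<w. \<forall>b<w. has_entry w i b \<longrightarrow> has_entry v (?i i) b"
  let ?P = "{(w, v). w \<in> lists {..<2} \<and> v \<in> lists {..<2} \<and> ?Q (list_encode w) (list_encode v)}"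
  have shift: "ext_act g z i = z (?i i)" if "z \<in> Ext" for z i
    using shift_eq[of z "r (pfst i)" "pfst i" g "psnd i"] that assms(3)
    by (simp add: ext_act_def Ext_def)
  show "ext_act g ` Ext \<subseteq> topspace (cantor_space 2)"
    using shift_Ext(1)[OF _ assms(1)] by (auto simp: ext_act_def Ext_def)
  show "?P \<subseteq> lists {..<2} \<times> lists {..<2}" by auto
  have r: "pr (\<lambda>x. r (f x))" if "pr f" for f using pr_comp[OF assms(2) that] .
  have "decidable (\<lambda>p. list_decode (pfst p) \<in> lists {..<2} \<and> list_decode (psnd p) \<in> lists {..<2} \<and>
      ?Q (pfst p) (psnd p))"
    by (intro decidable_intros decidable_in_lists decidable_has_entry r pr_intros)
  then show "re_word_pairs ?P"
    by (intro re_word_pairsI semidecidable_if_decidable) simp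
  fix w :: "nat list" assume w: "w \<in> lists {..<2}"
  have Q: "?Q (list_encode w) (list_encode v) \<longleftrightarrow> (\<forall>i<length w. ?i i < length v \<and> v ! ?i i = w ! i)" for v
    using has_entry_less[of "list_encode w"] by (auto simp: has_entry_iff)
  show "{z \<in> Ext. ext_act g z \<in> cylinder 2 w} = (\<Union>v\<in>{v. (w, v) \<in> ?P}. cylinder 2 v) \<inter> Ext"
  proof (intro equalityI subsetI)
    fix z assume "z \<in> {z \<in> Ext. ext_act g z \<in> cylinder 2 w}"
    then have z: "z \<in> Ext" "\<And>i. i < length w \<Longrightarrow> z (?i i) = w ! i"
      using shift by (auto simp: cylinder_def)
    then have z2: "z \<in> topspace (cantor_space 2)" by (simp add: Ext_def)
    obtain N where N: "\<And>i. i < length w \<Longrightarrow> ?i i < N"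
      using finite_nat_set_iff_bounded[of "?i ` {..<length w}"] by auto
    have "(w, map z [0..<N]) \<in> ?P"
      using w prefix_in_lists[OF z2] N z(2) by (auto simp only: Q mem_Collect_eq prod.case length_map length_upt) auto
    moreover have "z \<in> cylinder 2 (map z [0..<N])" using z2 by (simp add: cylinder_prefix)
    ultimately show "z \<in> (\<Union>v\<in>{v. (w, v) \<in> ?P}. cylinder 2 v) \<inter> Ext" using z(1) by blast
  next
    fix z assume "z \<in> (\<Union>v\<in>{v. (w, v) \<in> ?P}. cylinder 2 v) \<inter> Ext"
    then obtain v where v: "z \<in> Ext" "z \<in> cylinder 2 v"
      "\<And>i. i < length w \<Longrightarrow> ?i i < length v \<and> v ! ?i i = w ! i"
      using Q by auto
    then have "ext_act g z i = w ! i" if "i < length w" for i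
      using that shift[OF v(1)] by (auto simp: cylinder_def)
    moreover have "ext_act g z \<in> topspace (cantor_space 2)"
      using shift_Ext(1)[OF v(1) assms(1)] v(1) by (simp add: ext_act_def Ext_def)
    ultimately show "z \<in> {z \<in> Ext. ext_act g z \<in> cylinder 2 w}"
      using v(1) by (simp add: cylinder_def)
  qed
qed

end

section \<open>The main theorem\<close>

lemma factor_map_inverse:
  assumes "factor_map G X \<phi> Y \<psi> f" "homeomorphic_maps X Y f g"
    and "\<And>a x. a \<in> carrier G \<Longrightarrow> x \<in> topspace X \<Longrightarrow> \<phi> a x \<in> topspace X"
  shows "factor_map G Y \<psi> X \<phi> g"
proof -
  have f: "f ` topspace X = topspace Y" "\<And>a x. a \<in> carrier G \<Longrightarrow> x \<in> topspace X \<Longrightarrow> f (\<phi> a x) = \<psi> a (f x)"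
    using assms(1) unfolding factor_map_def by auto
  have g: "continuous_map Y X g" "\<And>x. x \<in> topspace X \<Longrightarrow> g (f x) = x"
    using assms(2) unfolding homeomorphic_maps_def by auto
  show ?thesis
    unfolding factor_map_def using f g assms(3) by (force simp flip: f(1) simp: image_image)
qed

lemma factor_map_compose:
  assumes "factor_map G X \<phi> Y \<psi> f" "factor_map G Y \<psi> Z \<omega> g"
  shows "factor_map G X \<phi> Z \<omega> (g \<circ> f)"
  unfolding factor_map_def
proof (intro conjI ballI)
  have fg: "continuous_map X Y f" "continuous_map Y Z g" "f ` topspace X = topspace Y" "g ` topspace Y = topspace Z"
    using assms by (auto simp: factor_map_def)
  show "continuous_map X Z (g \<circ> f)" using fg(1,2) by (rule continuous_map_compose)
  show "(g \<circ> f) ` topspace X = topspace Z" by (simp only: image_comp[symmetric] fg)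
  show "(g \<circ> f) (\<phi> a x) = \<omega> a ((g \<circ> f) x)" if "a \<in> carrier G" "x \<in> topspace X" for a x
  proof -
    have "f x \<in> topspace Y" using that(2) fg(3) by blast
    then show ?thesis using assms that by (simp add: factor_map_def)
  qed
qed

lemma image_set_encode_iff: "C \<in> set_encode ` {I. finite I \<and> P I} \<longleftrightarrow> P (set_decode C)"
  by (auto intro!: image_eqI[of _ _ "set_decode C"])

theorem theorem1:
  fixes G :: "('g, 'm) monoid_scheme"
    and X :: "'x topology"
    and \<phi> :: "'g \<Rightarrow> 'x \<Rightarrow> 'x"
  assumes "finitely_generated_group G"
    and "recursively_presented G"
    and "effective_dynamical_system TYPE('z) G X \<phi>"
  shows "\<exists>(Xt :: (nat \<Rightarrow> nat) set) (\<psi> :: 'g \<Rightarrow> (nat \<Rightarrow> nat) \<Rightarrow> (nat \<Rightarrow> nat)).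
           effectively_closed 2 Xt \<and>
           zero_dimensional (subtopology (cantor_space 2) Xt) \<and>
           computable_cantor_action G 2 Xt \<psi> \<and>
           topological_factor G (subtopology (cantor_space 2) Xt) \<psi> X \<phi>"
proof -
  interpret group G using assms(1) by (simp add: finitely_generated_group_def)
  obtain e :: "nat \<Rightarrow> 'g" and R where R: "finite R" "R \<subseteq> carrier G" "generate G R = carrier G"
    and e: "range e = carrier G" "semidecidable (\<lambda>p. e (pfst p) = e (psnd p))"
    and right: "\<And>s. s \<in> R \<Longrightarrow> \<exists>r. pr r \<and> (\<forall>c. e (r c) = e c \<otimes>\<^bsub>G\<^esub> s)"
    and left: "\<And>g. g \<in> carrier G \<Longrightarrow> \<exists>l. pr l \<and> (\<forall>c. e (l c) = g \<otimes>\<^bsub>G\<^esub> e c)"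
    by (rule group_coding[OF assms(2)], rule that)
  obtain Z :: "'z metric" and s K \<psi> where X: "topological_action G X \<phi>"
    and Z: "computable_metric_space Z s" and K: "recursively_compact Z s K"
    and \<psi>: "computable_metric_action G Z s K \<psi>"
    and conj: "topologically_conjugate G X \<phi> (subtopology (mtopology_of Z) K) \<psi>"
    using assms(3) unfolding effective_dynamical_system_def by blast
  obtain F where F: "semidecidable F"
    "\<And>a b. F (pair a b) \<Longrightarrow> basic_ball Z s a \<inter> basic_ball Z s b = {}"
    "\<And>x y. x \<in> mspace Z \<Longrightarrow> y \<in> mspace Z \<Longrightarrow> x \<noteq> y \<Longrightarrow>
       \<exists>a b. F (pair a b) \<and> x \<in> basic_ball Z s a \<and> y \<in> basic_ball Z s b"
    by (rule formally_disjoint_balls[OF Z], rule that)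
  let ?T = "subtopology (mtopology_of Z) K"
  have compactin: "compactin (mtopology_of Z) K"
    and re_cover: "recursively_enumerable (set_encode ` {I. finite I \<and> K \<subseteq> basic_union Z s I})"
    using K unfolding recursively_compact_def by auto
  have K_sub: "K \<subseteq> mspace Z" using compactin_subset_topspace[OF compactin] by simp
  have T: "topspace ?T = K" using K_sub by auto
  have action: "topological_action G ?T \<psi>" using \<psi> unfolding computable_metric_action_def by blast
  obtain S1 where S1: "finite S1" "S1 \<subseteq> carrier G" "generate G S1 = carrier G"
    "\<And>g. g \<in> S1 \<Longrightarrow> computable_metric_map Z s K Z s (\<psi> g)"
    using \<psi> unfolding computable_metric_action_def by blast
  \<comment> \<open>The identity is added because \<open>S1\<close> may be empty;
    \<open>locally_coded\<close> would then provide no point at a code.\<close>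
  let ?S = "insert \<one>\<^bsub>G\<^esub> S1"
  have action': "group_action G K \<psi>" using action T unfolding topological_action_def by simp
  have "\<exists>I. semidecidable (\<lambda>p. psnd p \<in> I (pfst p)) \<and>
      (\<forall>m. {x \<in> K. \<psi> g x \<in> basic_ball Z s m} = basic_union Z s (I m) \<inter> K)" if g: "g \<in> ?S" for g
  proof (cases "g \<in> S1")
    case True
    then obtain I where I: "recursively_enumerable {prod_encode (m, n) | m n. n \<in> I m}"
      "\<And>m. {x \<in> K. \<psi> g x \<in> basic_ball Z s m} = basic_union Z s (I m) \<inter> K"
      using S1(4)[OF True] unfolding computable_metric_map_def by blast
    have "p \<in> {prod_encode (m, n) | m n. n \<in> I m} \<longleftrightarrow> psnd p \<in> I (pfst p)" for p
      unfolding prod_encode_pair mem_Collect_eq by (metis pair_pfst_psnd pfst_pair psnd_pair)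
    then show ?thesis
      using semidecidable_if_recursively_enumerable[OF I(1)] I(2) by auto
  next
    case False
    then have "g = \<one>\<^bsub>G\<^esub>" using g by blast
    then have "\<psi> g x = x" if "x \<in> K" for x
      using group_action.id_eq_one[OF action'] that by (metis restrict_apply')
    then have "{x \<in> K. \<psi> g x \<in> basic_ball Z s m} = basic_union Z s {m} \<inter> K" for m
      by (auto simp: basic_union_def)
    moreover have "semidecidable (\<lambda>p. psnd p \<in> {pfst p})"
      using semidecidable_if_decidable[OF decidable_eq[OF pr_psnd_basic pr_pfst_basic]] by simp
    ultimately show ?thesis by (intro exI[of _ "\<lambda>m. {m}"]) auto
  qed
  then obtain I where I: "\<And>g. g \<in> ?S \<Longrightarrow> semidecidable (\<lambda>p. psnd p \<in> I g (pfst p))"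
    "\<And>g m. g \<in> ?S \<Longrightarrow> {x \<in> K. \<psi> g x \<in> basic_ball Z s m} = basic_union Z s (I g m) \<inter> K"
    by metis
  have S: "finite ?S" "?S \<subseteq> carrier G" "generate G ?S = carrier G"
    using S1 mono_generate[of S1 ?S] generate_incl[of ?S] by auto
  obtain l where l: "\<And>g. g \<in> ?S \<Longrightarrow> pr (l g)" "\<And>g c. g \<in> ?S \<Longrightarrow> e (l g c) = g \<otimes>\<^bsub>G\<^esub> e c"
    using left S(2) by (metis subsetD)
  have cover: "C \<in> set_encode ` {I. finite I \<and> K \<subseteq> basic_union Z s I} \<longleftrightarrow>
      K \<subseteq> (\<Union>n\<in>set_decode C. basic_ball Z s n)" for C
    unfolding image_set_encode_iff basic_union_def ..
  interpret effective_action G e ?T \<psi> "basic_ball Z s" F ?S I l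
  proof (intro effective_action.intro coded_action.intro coded_action_axioms.intro effective_action_axioms.intro)
    show "openin ?T (basic_ball Z s n \<inter> topspace ?T)" for n
    proof -
      have "openin (mtopology_of Z) (basic_ball Z s n)"
        unfolding basic_ball_eq mtopology_of_def
        by (intro Metric_space.openin_mball Metric_space_mspace_mdist)
      then show ?thesis unfolding T by (auto simp: openin_subtopology)
    qed
    show "semidecidable (\<lambda>C. topspace ?T \<subseteq> (\<Union>n\<in>set_decode C. basic_ball Z s n))"
      using semidecidable_if_recursively_enumerable[OF re_cover] unfolding T cover .
    show "{x \<in> topspace ?T. \<psi> g x \<in> basic_ball Z s m} = (\<Union>n\<in>I g m. basic_ball Z s n) \<inter> topspace ?T"
      if "g \<in> ?S" for g m
      using I(2)[OF that] unfolding T basic_union_def .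
    show "compact_space ?T" using compactin by (rule compact_space_subtopology)
    show "group_action G (topspace ?T) \<psi>" unfolding T by (rule action')
    show "\<exists>a b. F (pair a b) \<and> x \<in> basic_ball Z s a \<and> y \<in> basic_ball Z s b"
      if "x \<in> topspace ?T" "y \<in> topspace ?T" "x \<noteq> y" for x y
      using that F(3) K_sub unfolding T by blast
  qed (use e F S I(1) l is_group in auto)
  have closed: "closedin (cantor_space 2) Ext"
    using effectively_closed_Ext by (rule closedin_if_effectively_closed)
  \<comment> \<open>Computability is shown on the generators \<open>R\<close> of the presentation,
    for which right multiplication of codes is primitive recursive; \<open>S1\<close> enters only
    through the membership in \<open>Ext\<close>.\<close>
  have "computable_cantor_action G 2 Ext ext_act"
    unfolding computable_cantor_action_def
  proof (intro conjI exI[of _ R] ballI R topological_action_ext_act closed)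
    fix g assume g: "g \<in> R"
    then obtain r where "pr r" "\<And>c. e (r c) = e c \<otimes>\<^bsub>G\<^esub> g" using right by blast
    then show "computable_cantor_map 2 Ext 2 (ext_act g)"
      using computable_ext_act[of g r] g R(2) by blast
  qed
  moreover have "topological_factor G ExtT ext_act X \<phi>"
  proof -
    obtain f g where f: "factor_map G X \<phi> ?T \<psi> f" "homeomorphic_maps X ?T f g"
      using conj unfolding topologically_conjugate_def homeomorphic_map_maps by blast
    have "group_action G (topspace X) \<phi>" using X unfolding topological_action_def by blast
    then have "factor_map G ?T \<psi> X \<phi> g"
      using factor_map_inverse[OF f] group_action.element_image by metis
    then show ?thesis
      unfolding topological_factor_def using factor_map_compose[OF factor_map_point] by blast
  qed
  ultimately show ?thesis
    using effectively_closed_Ext zero_dimensional_closed_subset[OF closed] by blast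
qed

end
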